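(* Let $k$ be a field of characteristic zero, and let $h=(1,h_1=r,h_2,\dots,h_e)$ be an $h$-vector such that, for every $i\ge 2$, the inequality $((h_i)_{(i)})_{-1}^{-1}\neq h_{i-1}$ implies the equality $((h_i)_{(i)})_{+1}^{+1}=h_{i+1}$. Then there exists a unique socle-vector associated to $h$, i.e. all standard graded artinian $k$-algebras with $h$-vector $h$ have the same socle-vector.
   Context: Algebras are standard graded artinian $k$-algebras $A=R/I$, with $R=k[x_1,\dots,x_r]$, $k$ a field of characteristic zero, and $I$ a homogeneous ideal containing no non-zero forms of degree 1. The $h$-vector of $A$ is $h(A)=(h_0,h_1,\dots,h_e)$, where $h_i=\dim_k A_i$ and $e\ge 1$ is the last index with $A_e\neq 0$; thus $h_0=1$ and $h_1=r$. Set $h_i=0$ for $i>e$. The socle of $A$ is $soc(A)=\{a\in A : a\overline{m}=0\}$, where $\overline m=(\overline{x_1},\dots,\overline{x_r})$, and the socle-vector of $A$ is $s(A)=(s_0,s_1,\dots,s_e)$ with $s_i=\dim_k soc(A)_i$. "An $h$-vector" means a tuple that is the $h$-vector of some such algebra. For positive integers $n,i$, the $i$-binomial expansion of $n$ is the unique expression $n_{(i)}=\binom{n_i}{i}+\binom{n_{i-1}}{i-1}+\dots+\binom{n_j}{j}$ with $n_i>n_{i-1}>\dots>n_j\ge j\ge 1$. For an integer $a$, $(n_{(i)})_a^a=\binom{n_i+a}{i+a}+\binom{n_{i-1}+a}{i-1+a}+\dots+\binom{n_j+a}{j+a}$ (with $\binom{m}{0}=1$ for $m\ge 0$). By convention $(0_{(i)})_a^a=0$.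 *)

theory Defs
  imports
    Complex_Main
    "HOL-Library.Poly_Mapping"
    "HOL-Algebra.QuotRing"
    "HOL-Algebra.Embedded_Algebras"
begin

text \<open>
  A polynomial over \<open>'k\<close> is a finitely supported map from exponent vectors to coefficients; the
  product on \<^typ>\<open>(nat \<Rightarrow>\<^sub>0 nat) \<Rightarrow>\<^sub>0 'k::comm_ring_1\<close> is the convolution product, i.e. the usual
  multiplication of polynomials. The variables $x_1, \ldots, x_r$ carry the indices \<open>0, \<dots>, r - 1\<close>.
\<close>

type_synonym 'k mpoly = "(nat \<Rightarrow>\<^sub>0 nat) \<Rightarrow>\<^sub>0 'k"

definition poly_ring :: "nat \<Rightarrow> 'k::field mpoly ring" where
  "poly_ring r =
    \<lparr>carrier = {p. \<forall>m \<in> Poly_Mapping.keys p. Poly_Mapping.keys m \<subseteq> {..<r}},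
     mult = (*), one = 1, zero = 0, add = (+)\<rparr>"

definition poly_const :: "'k::field \<Rightarrow> 'k mpoly" where
  "poly_const c = Poly_Mapping.single 0 c"

definition poly_var :: "nat \<Rightarrow> 'k::field mpoly" where
  "poly_var i = Poly_Mapping.single (Poly_Mapping.single i 1) 1"

definition mdeg :: "(nat \<Rightarrow>\<^sub>0 nat) \<Rightarrow> nat" where
  "mdeg m = (\<Sum>i \<in> Poly_Mapping.keys m. Poly_Mapping.lookup m i)"

definition forms :: "nat \<Rightarrow> nat \<Rightarrow> 'k::field mpoly set" where
  "forms r d = {p \<in> carrier (poly_ring r). \<forall>m \<in> Poly_Mapping.keys p. mdeg m = d}"

definition hom_part :: "nat \<Rightarrow> 'k::field mpoly \<Rightarrow> 'k mpoly" where
  "hom_part d p = Poly_Mapping.mapp (\<lambda>m c. if mdeg m = d then c else 0) p"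

definition homogeneous_ideal :: "nat \<Rightarrow> 'k::field mpoly set \<Rightarrow> bool" where
  "homogeneous_ideal r I \<longleftrightarrow> ideal I (poly_ring r) \<and> (\<forall>p \<in> I. \<forall>d. hom_part d p \<in> I)"

definition artinian :: "('a, 'b) ring_scheme \<Rightarrow> bool" where
  "artinian A \<longleftrightarrow>
    (\<forall>J :: nat \<Rightarrow> 'a set. (\<forall>n. ideal (J n) A \<and> J (Suc n) \<subseteq> J n) \<longrightarrow> (\<exists>N. \<forall>n \<ge> N. J n = J N))"

abbreviation quot_alg :: "nat \<Rightarrow> 'k::field mpoly set \<Rightarrow> 'k mpoly set ring" where
  "quot_alg r I \<equiv> poly_ring r Quot I"

abbreviation quot_class :: "nat \<Rightarrow> 'k::field mpoly set \<Rightarrow> 'k mpoly \<Rightarrow> 'k mpoly set" where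
  "quot_class r I p \<equiv> I +>\<^bsub>poly_ring r\<^esub> p"

definition graded_piece :: "nat \<Rightarrow> 'k::field mpoly set \<Rightarrow> nat \<Rightarrow> 'k mpoly set set" where
  "graded_piece r I d = quot_class r I ` forms r d"

text \<open>
  The condition \<open>r \<ge> 1\<close> is the requirement that the last non-zero degree $e$ of $A$ is at least 1:
  since \<open>I\<close> contains no non-zero linear form, it only excludes the case $A = k$ ($r = 0$), as well
  as the zero algebra.
\<close>

definition std_graded_artinian :: "nat \<Rightarrow> 'k::field mpoly set \<Rightarrow> bool" where
  "std_graded_artinian r I \<longleftrightarrow>
    r \<ge> 1 \<and> homogeneous_ideal r I \<and> I \<inter> forms r 1 = {0} \<and> artinian (quot_alg r I)"

text \<open>
  The base field enters the library's dimension \<^const>\<open>ring.dim\<close> as a subfield of the ring, here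
  the image of the constants in $A$.
\<close>

definition dim_over_base :: "nat \<Rightarrow> 'k::field mpoly set \<Rightarrow> 'k mpoly set set \<Rightarrow> nat" where
  "dim_over_base r I V = ring.dim (quot_alg r I) (quot_class r I ` range poly_const) V"

text \<open>
  The tuples $(h_0, \ldots, h_e)$ and $(s_0, \ldots, s_e)$ are extended by zero to all of \<^typ>\<open>nat\<close>,
  which happens by itself because $A_i = 0$ for $i > e$.
\<close>

definition h_vector :: "nat \<Rightarrow> 'k::field mpoly set \<Rightarrow> nat \<Rightarrow> nat" where
  "h_vector r I i = dim_over_base r I (graded_piece r I i)"

definition max_ideal :: "nat \<Rightarrow> 'k::field mpoly set \<Rightarrow> 'k mpoly set set" where
  "max_ideal r I = genideal (quot_alg r I) (quot_class r I ` poly_var ` {..<r})"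

definition socle :: "nat \<Rightarrow> 'k::field mpoly set \<Rightarrow> 'k mpoly set set" where
  "socle r I =
    {a \<in> carrier (quot_alg r I).
      \<forall>m \<in> max_ideal r I. a \<otimes>\<^bsub>quot_alg r I\<^esub> m = \<zero>\<^bsub>quot_alg r I\<^esub>}"

definition socle_vector :: "nat \<Rightarrow> 'k::field mpoly set \<Rightarrow> nat \<Rightarrow> nat" where
  "socle_vector r I i = dim_over_base r I (socle r I \<inter> graded_piece r I i)"

definition is_binomial_expansion :: "nat \<Rightarrow> nat \<Rightarrow> nat \<Rightarrow> (nat \<Rightarrow> nat) \<Rightarrow> bool" where
  "is_binomial_expansion n i j c \<longleftrightarrow>
    1 \<le> j \<and> j \<le> i \<and> j \<le> c j \<and> strict_mono_on {j..i} c \<and> n = (\<Sum>t = j..i. c t choose t)"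

text \<open>Binomial coefficients with a negative argument are 0.\<close>

definition int_choose :: "int \<Rightarrow> int \<Rightarrow> nat" where
  "int_choose m l = (if 0 \<le> m \<and> 0 \<le> l then nat m choose nat l else 0)"

text \<open>
  \<open>binomial_shift n i a\<close> is $(n_{(i)})^a_a$. It is well defined for \<open>i \<ge> 1\<close> because the top entries of
  the \<open>i\<close>-binomial expansion of a positive \<open>n\<close> exist and are unique on \<open>{j..i}\<close>.
\<close>

definition binomial_shift :: "nat \<Rightarrow> nat \<Rightarrow> int \<Rightarrow> nat" where
  "binomial_shift n i a =
    (if n = 0 then 0
     else THE v. \<exists>j c. is_binomial_expansion n i j c \<and>
                       v = (\<Sum>t = j..i. int_choose (int (c t) + a) (int t + a)))"

end

theory Submission
  imports Defs "HOL-Computational_Algebra.Polynomial"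
begin

text \<open>
  The socle-vector is determined by the h-vector through
  $s_i = h_i - ((h_{i+1})_{(i+1)})^{-1}_{-1}$ in every degree (\<open>socle_vector_formula\<close>). The degree \<open>i\<close> part
  of the socle is the image of the forms \<open>F\<close> in $R_i$ such that $R_1 F \subseteq I$, so the codimension
  of this space of forms must be shown to equal the shift of $h_{i+1}$.

  Both inequalities come from one tool, Green's theorem (\<open>green_rank_bound\<close>): if a subspace \<open>V\<close> of
  $R_{d+1}$ has codimension \<open>c\<close>, then multiplication by some linear form $l : R_d \to R_{d+1}/V$ has rank at
  least $(c_{(d+1)})^{-1}_{-1}$. For $V = I_{i+1}$ the kernel of this map contains the socle forms, whence
  $h_i - s_i \geq ((h_{i+1})_{(i+1)})^{-1}_{-1}$. If the right-hand side equals $h_i$, then $s_i = 0$. Otherwise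
  the hypothesis says that the growth from degree \<open>i + 1\<close> to \<open>i + 2\<close> is maximal. Then Green's theorem
  in degree \<open>i + 2\<close> produces a linear form \<open>l\<close> that is injective on $A_{i+1}$; every form of degree \<open>i\<close> killed
  by such an \<open>l\<close> is a socle form, and Green's theorem applied to \<open>A / l A\<close> bounds the rank of \<open>l\<close> on $A_i$
  from above by the same number (\<open>codim_socle_forms_le_rank_bound\<close>).

  Green's theorem is proved by induction on degree and codimension, comparing the best linear form
  with a second, general one. The general position needed is only that two rank conditions hold for a
  common linear form, and this is checked on a line (\<open>common_generic_linear_form\<close>). The combinatorial
  input is \<open>rank_bound_le_of_split\<close>. All dimension counts take place among subspaces of the spaces of
  forms; only at the end are they carried over to the quotient algebra (\<open>dim_over_base_image\<close>).
\<close>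

section \<open>Shifts of binomial expansions\<close>

text \<open>
  For \<open>d \<ge> 1\<close> this is the top entry of the \<open>d\<close>-binomial expansion of \<open>n\<close>. Peeling top entries off
  greedily turns every sum over an expansion into a recursion on \<open>d\<close>. The greedy expansion always
  runs down to \<open>t = 1\<close>: once the remainder is 0, the entry at \<open>t\<close> is \<open>t - 1\<close>, whose binomial
  coefficient vanishes.
\<close>

definition top_entry :: "nat \<Rightarrow> nat \<Rightarrow> nat" where
  "top_entry d n = (GREATEST N. N choose d \<le> n)"

fun expansion_sum :: "(nat \<Rightarrow> nat \<Rightarrow> nat) \<Rightarrow> nat \<Rightarrow> nat \<Rightarrow> nat" where
  "expansion_sum f 0 n = 0"
| "expansion_sum f (Suc d) n =
    f (top_entry (Suc d) n) (Suc d)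
      + expansion_sum f d (n - (top_entry (Suc d) n choose Suc d))"

text \<open>
  Green's function $n_{\langle d\rangle} = \sum_t \binom{n_t - 1}{t}$, which bounds the dimension
  left after restriction to a general hyperplane.
\<close>

definition restrict_bound :: "nat \<Rightarrow> nat \<Rightarrow> nat" where
  "restrict_bound = expansion_sum (\<lambda>N t. (N - 1) choose t)"

text \<open>
  The excess of Macaulay's maximal growth over \<open>n\<close>: by Pascal's rule,
  $(n_{(d)})^{+1}_{+1} = n + \sum_t \binom{n_t}{t+1}$.
\<close>

definition growth_excess :: "nat \<Rightarrow> nat \<Rightarrow> nat" where
  "growth_excess = expansion_sum (\<lambda>N t. N choose Suc t)"

text \<open>
  By Pascal's rule this is $(n_{(d)})^{-1}_{-1}$. As a difference it needs no convention for
  the terms \<open>t - 1\<close> by which the greedy expansion is padded.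
\<close>

definition rank_bound :: "nat \<Rightarrow> nat \<Rightarrow> nat" where
  "rank_bound d n = n - restrict_bound d n"

lemma top_entry_eq:
  assumes "x < N choose d"
  shows "top_entry (Suc d) ((N choose Suc d) + x) = N"
  unfolding top_entry_def
proof (rule Greatest_equality)
  show "N choose Suc d \<le> (N choose Suc d) + x" by simp
  fix M assume M: "M choose Suc d \<le> (N choose Suc d) + x"
  show "M \<le> N"
  proof (rule ccontr)
    assume "\<not> M \<le> N"
    then have "Suc N choose Suc d \<le> M choose Suc d" by (intro binomial_right_mono) auto
    with M assms show False by simp
  qed
qed

lemma expansion_sum_step:
  assumes "x < N choose d"
  shows "expansion_sum f (Suc d) ((N choose Suc d) + x) = f N (Suc d) + expansion_sum f d x"
  using top_entry_eq[OF assms] by simp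

lemma greedy_decomposition:
  obtains N x where "n = (N choose Suc d) + x" "x < N choose d"
proof -
  have bound: "N \<le> n + d" if "N choose Suc d \<le> n" for N
  proof (rule ccontr)
    assume "\<not> N \<le> n + d"
    then have "Suc (n + d) choose Suc d \<le> N choose Suc d" by (intro binomial_right_mono) auto
    moreover have "Suc n \<le> Suc (n + d) choose Suc d"
      by (induction d) auto
    ultimately show False using that by simp
  qed
  define N where "N = (GREATEST N. N choose Suc d \<le> n)"
  have le: "N choose Suc d \<le> n" unfolding N_def
    by (rule GreatestI_nat[of _ 0 "n + d"]) (auto intro: bound)
  have "n < Suc N choose Suc d"
  proof (rule ccontr)
    assume "\<not> n < Suc N choose Suc d"
    then have "Suc N \<le> N" unfolding N_def
      by (intro Greatest_le_nat[of _ _ "n + d"]) (auto intro: bound simp: N_def)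
    then show False by simp
  qed
  with le that[of N "n - (N choose Suc d)"] show ?thesis by simp
qed

lemmas restrict_bound_step =
  expansion_sum_step[of _ _ _ "\<lambda>N t. (N - 1) choose t", folded restrict_bound_def]
lemmas growth_excess_step =
  expansion_sum_step[of _ _ _ "\<lambda>N t. N choose Suc t", folded growth_excess_def]

lemma restrict_bound_0_left [simp]: "restrict_bound 0 n = 0"
  by (simp add: restrict_bound_def)

lemma growth_excess_0_left [simp]: "growth_excess 0 n = 0"
  by (simp add: growth_excess_def)

lemma restrict_bound_0 [simp]: "restrict_bound d 0 = 0"
proof (induction d)
  case (Suc d)
  then show ?case using restrict_bound_step[of 0 d d] by (simp add: binomial_eq_0)
qed simp

lemma restrict_bound_1: "restrict_bound (Suc 0) n = n - 1"
  using restrict_bound_step[of 0 n 0] by simp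

lemma restrict_bound_choose:
  assumes "d \<le> N" shows "restrict_bound (Suc d) (N choose Suc d) = (N - 1) choose Suc d"
  using restrict_bound_step[of 0 N d] assms by simp

lemma pascal_pred: "1 \<le> N \<Longrightarrow> N choose Suc d = ((N - 1) choose d) + ((N - 1) choose Suc d)"
  by (cases N) simp_all

text \<open>
  The recursion survives at the boundary \<open>x = N choose d\<close>, where the top entry jumps to
  \<open>N + 1\<close>: both sides then agree by Pascal's rule. This is what lets the step from \<open>n\<close> to \<open>n + 1\<close> be
  followed by induction on \<open>d\<close>, without comparing expansions.
\<close>

lemma restrict_bound_step_le:
  assumes d: "1 \<le> d" and x: "x \<le> N choose d"
  shows "restrict_bound (Suc d) ((N choose Suc d) + x) = ((N - 1) choose Suc d) + restrict_bound d x"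
proof (cases "x < N choose d")
  case True
  then show ?thesis by (rule restrict_bound_step)
next
  case False
  with x have x: "x = N choose d" by simp
  show ?thesis
  proof (cases "d \<le> N")
    case True
    obtain e where e: "d = Suc e" using d by (cases d) auto
    have "restrict_bound (Suc d) ((N choose Suc d) + x) = N choose Suc d"
      using restrict_bound_choose[of d "Suc N"] True x by (simp add: add.commute)
    moreover have "restrict_bound d x = (N - 1) choose d"
      using restrict_bound_choose[of e N] True x e by simp
    ultimately show ?thesis using pascal_pred[of N d] True d by simp
  next
    case False
    then show ?thesis using x by (simp add: binomial_eq_0)
  qed
qed

text \<open>
  Since a unit step raises \<^const>\<open>restrict_bound\<close> by 0 or 1, both it and its complement
  \<^const>\<open>rank_bound\<close> are monotone.
\<close>

lemma restrict_bound_Suc: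
  "restrict_bound d n \<le> restrict_bound d (Suc n) \<and> restrict_bound d (Suc n) \<le> Suc (restrict_bound d n)"
proof (induction d arbitrary: n)
  case (Suc d)
  show ?case
  proof (cases d)
    case 0
    then show ?thesis by (simp add: restrict_bound_1)
  next
    case d: (Suc e)
    obtain N x where n: "n = (N choose Suc d) + x" and x: "x < N choose d"
      by (rule greedy_decomposition)
    have "restrict_bound (Suc d) n = ((N - 1) choose Suc d) + restrict_bound d x"
      unfolding n by (rule restrict_bound_step[OF x])
    moreover have "restrict_bound (Suc d) (Suc n) = ((N - 1) choose Suc d) + restrict_bound d (Suc x)"
      using restrict_bound_step_le[of d "Suc x" N] x d n by simp
    ultimately show ?thesis using Suc.IH[of x] by simp
  qed
qed simp

lemma restrict_bound_mono: "m \<le> n \<Longrightarrow> restrict_bound d m \<le> restrict_bound d n"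
  by (rule lift_Suc_mono_le) (simp_all add: restrict_bound_Suc)

lemma restrict_bound_le: "restrict_bound d n \<le> n"
proof (induction n)
  case (Suc n)
  then show ?case using restrict_bound_Suc[of d n] by linarith
qed simp

lemma rank_bound_mono: "m \<le> n \<Longrightarrow> rank_bound d m \<le> rank_bound d n"
proof (rule lift_Suc_mono_le[of "rank_bound d"])
  show "rank_bound d n \<le> rank_bound d (Suc n)" for n
    using restrict_bound_Suc[of d n] restrict_bound_le[of d n] unfolding rank_bound_def by linarith
qed

lemma rank_plus_restrict: "rank_bound d n + restrict_bound d n = n"
  using restrict_bound_le[of d n] by (simp add: rank_bound_def)

lemma rank_bound_0 [simp]: "rank_bound d 0 = 0"
  by (simp add: rank_bound_def)

lemma rank_bound_1_right: "rank_bound (Suc d) 1 = 1"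
  using restrict_bound_choose[of d "Suc d"] by (simp add: rank_bound_def binomial_eq_0)

lemma rank_bound_1_left: "1 \<le> n \<Longrightarrow> rank_bound (Suc 0) n = 1"
  by (simp add: rank_bound_def restrict_bound_1)

text \<open>
  The step up to \<open>N choose d\<close> is one of those that raise the bound, because just below it the
  expansion is the full string \<open>N - 1, N - 2, \<dots>\<close>.
\<close>

lemma restrict_bound_less_choose:
  assumes "c < N choose Suc d" and "Suc d < N"
  shows "restrict_bound (Suc d) c < (N - 1) choose Suc d"
  using assms
proof (induction d arbitrary: c N)
  case 0
  then show ?case by (simp add: restrict_bound_1)
next
  case (Suc d)
  then obtain M where M: "N = Suc M" by (cases N) auto
  have pos: "0 < M choose Suc d" using Suc.prems M by simp
  have "restrict_bound (Suc (Suc d)) c \<le> restrict_bound (Suc (Suc d)) ((N choose Suc (Suc d)) - 1)"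
    using Suc.prems by (intro restrict_bound_mono) simp
  also have "(N choose Suc (Suc d)) - 1 = (M choose Suc (Suc d)) + ((M choose Suc d) - 1)"
    unfolding M binomial_Suc_Suc using pos by linarith
  also have "restrict_bound (Suc (Suc d)) \<dots>
      = ((M - 1) choose Suc (Suc d)) + restrict_bound (Suc d) ((M choose Suc d) - 1)"
    using pos by (intro restrict_bound_step) simp
  also have "\<dots> < ((M - 1) choose Suc (Suc d)) + ((M - 1) choose Suc d)"
    using Suc.IH[of "(M choose Suc d) - 1" M] pos Suc.prems M by simp
  also have "\<dots> = M choose Suc (Suc d)" using pascal_pred[of M "Suc d"] Suc.prems M by simp
  finally show ?case using M by simp
qed

lemma rank_bound_step_le:
  assumes "1 \<le> d" "1 \<le> N" "x \<le> N choose d"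
  shows "rank_bound (Suc d) ((N choose Suc d) + x) = ((N - 1) choose d) + rank_bound d x"
  using restrict_bound_step_le[OF assms(1,3)] pascal_pred[OF assms(2), of d]
    restrict_bound_le[of d x] unfolding rank_bound_def by linarith

lemma rank_bound_choose:
  assumes "Suc d \<le> N" shows "rank_bound (Suc d) (N choose Suc d) = (N - 1) choose d"
  using restrict_bound_choose[of d N] pascal_pred[of N d] assms unfolding rank_bound_def by simp

text \<open>
  If $n_t$ are the entries of \<open>c\<close>, the left-hand side is at most
  $\sum_{t \geq 2} \binom{n_t - 2}{t - 1}$ and the right-hand side is one more than this sum. In effect,
  a split of \<open>c\<close> into a part just below the rank bound and a part just above the restriction bound is
  unbalanced.
\<close>

lemma restrict_rank_exchange:
  assumes "1 \<le> c"
  shows "restrict_bound d (rank_bound (Suc d) c - 1)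
    < rank_bound (Suc d) (restrict_bound (Suc d) c + 1)"
  using assms
proof (induction d arbitrary: c)
  case 0
  then show ?case by (simp add: rank_bound_1_left)
next
  case (Suc d)
  obtain N x where c: "c = (N choose Suc (Suc d)) + x" and x: "x < N choose Suc d"
    by (rule greedy_decomposition)
  from x have N: "Suc d \<le> N" by (metis binomial_eq_0 not_less0 not_le)
  have U: "restrict_bound (Suc (Suc d)) c = ((N - 1) choose Suc (Suc d)) + restrict_bound (Suc d) x"
    unfolding c by (rule restrict_bound_step[OF x])
  have L: "rank_bound (Suc (Suc d)) c = ((N - 1) choose Suc d) + rank_bound (Suc d) x"
    unfolding c using x N by (intro rank_bound_step_le) auto
  have NN: "Suc (Suc d) \<le> N"
  proof (rule ccontr)
    assume "\<not> Suc (Suc d) \<le> N"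
    with N have "N = Suc d" by simp
    with c x Suc.prems show False by (simp add: binomial_eq_0)
  qed
  show ?case
  proof (cases "x = 0")
    case True
    have "rank_bound (Suc (Suc d)) (restrict_bound (Suc (Suc d)) c + 1)
        = ((N - 1 - 1) choose Suc d) + rank_bound (Suc d) 1"
      using U True rank_bound_step_le[of "Suc d" "N - 1" 1] NN by (simp add: Suc_le_eq)
    moreover have "restrict_bound (Suc d) (rank_bound (Suc (Suc d)) c - 1)
        \<le> restrict_bound (Suc d) ((N - 1) choose Suc d)"
      using L True by (intro restrict_bound_mono) simp
    moreover have "restrict_bound (Suc d) ((N - 1) choose Suc d) = (N - 1 - 1) choose Suc d"
      using NN by (intro restrict_bound_choose) simp
    ultimately show ?thesis using rank_bound_1_right[of d] by simp
  next
    case False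
    have x1: "restrict_bound (Suc d) x + 1 \<le> (N - 1) choose Suc d"
      using restrict_bound_less_choose[OF x] NN by simp
    have "rank_bound (Suc d) x \<le> rank_bound (Suc d) (N choose Suc d)"
      using x by (intro rank_bound_mono) simp
    then have x2: "rank_bound (Suc d) x \<le> (N - 1) choose d"
      using rank_bound_choose[OF N] by simp
    have x3: "1 \<le> rank_bound (Suc d) x"
      using rank_bound_mono[of 1 x "Suc d"] rank_bound_1_right[of d] False by simp
    have "restrict_bound (Suc d) (rank_bound (Suc (Suc d)) c - 1)
        = restrict_bound (Suc d) (((N - 1) choose Suc d) + (rank_bound (Suc d) x - 1))"
      using L x3 by simp
    also have "\<dots> = ((N - 1 - 1) choose Suc d) + restrict_bound d (rank_bound (Suc d) x - 1)"
      using x2 x3 by (intro restrict_bound_step) simp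
    also have "\<dots> < ((N - 1 - 1) choose Suc d) + rank_bound (Suc d) (restrict_bound (Suc d) x + 1)"
      using Suc.IH[of x] False by simp
    also have "\<dots> = rank_bound (Suc (Suc d)) (((N - 1) choose Suc (Suc d)) + (restrict_bound (Suc d) x + 1))"
      using x1 NN by (intro rank_bound_step_le[symmetric]) auto
    also have "\<dots> = rank_bound (Suc (Suc d)) (restrict_bound (Suc (Suc d)) c + 1)"
      using U by (simp add: add.assoc)
    finally show ?thesis .
  qed
qed

text \<open>
  The arithmetic of the induction in Green's theorem: a rank \<open>\<rho>\<close> that dominates the bounds for
  the two pieces \<open>\<rho>\<close> and \<open>c - \<rho>\<close> dominates the bound for \<open>c\<close>.
\<close>

lemma rank_bound_le_of_split:
  assumes split: "rank_bound (Suc d) (c - \<rho>) + rank_bound d \<rho> \<le> \<rho>" and "\<rho> \<le> c"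
  shows "rank_bound (Suc d) c \<le> \<rho>"
proof (rule ccontr)
  assume "\<not> rank_bound (Suc d) c \<le> \<rho>"
  then have lt: "\<rho> < rank_bound (Suc d) c" by simp
  then have c: "1 \<le> c" using rank_plus_restrict[of "Suc d" c] by linarith
  have "restrict_bound d \<rho> \<le> restrict_bound d (rank_bound (Suc d) c - 1)"
    using lt by (intro restrict_bound_mono) simp
  also have "\<dots> < rank_bound (Suc d) (restrict_bound (Suc d) c + 1)"
    by (rule restrict_rank_exchange[OF c])
  also have "\<dots> \<le> rank_bound (Suc d) (c - \<rho>)"
    using lt rank_plus_restrict[of "Suc d" c] by (intro rank_bound_mono) linarith
  finally show False using split rank_plus_restrict[of d \<rho>] by linarith
qed

lemma growth_excess_bounds:
  assumes "x < N choose d"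
  shows "growth_excess d x \<le> N choose Suc d"
    and "x + growth_excess d x < Suc N choose Suc d"
proof -
  have "growth_excess d x \<le> N choose Suc d \<and> x + growth_excess d x < Suc N choose Suc d"
    using assms
  proof (induction d arbitrary: x N)
    case 0
    then show ?case by simp
  next
    case (Suc d)
    obtain M y where x: "x = (M choose Suc d) + y" and y: "y < M choose d"
      by (rule greedy_decomposition)
    have "M < N"
    proof (rule ccontr)
      assume "\<not> M < N"
      then have "N choose Suc d \<le> M choose Suc d" by (intro binomial_right_mono) auto
      with Suc.prems x show False by simp
    qed
    then have "Suc M choose Suc (Suc d) \<le> N choose Suc (Suc d)"
      and "Suc (Suc M) choose Suc (Suc d) \<le> Suc N choose Suc (Suc d)"
      by (intro binomial_right_mono; simp)+
    moreover have "growth_excess (Suc d) x = (M choose Suc (Suc d)) + growth_excess d y"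
      unfolding x by (rule growth_excess_step[OF y])
    ultimately show ?case using Suc.IH[OF y] x by auto
  qed
  then show "growth_excess d x \<le> N choose Suc d" "x + growth_excess d x < Suc N choose Suc d"
    by auto
qed

lemma restrict_bound_growth:
  assumes "d = 0 \<Longrightarrow> n = 0"
  shows "restrict_bound (Suc d) (n + growth_excess d n) = growth_excess d n"
  using assms
proof (induction d arbitrary: n)
  case (Suc d)
  obtain N x where n: "n = (N choose Suc d) + x" and x: "x < N choose d"
    by (rule greedy_decomposition)
  have T: "growth_excess (Suc d) n = (N choose Suc (Suc d)) + growth_excess d x"
    unfolding n by (rule growth_excess_step[OF x])
  have "n + growth_excess (Suc d) n = (Suc N choose Suc (Suc d)) + (x + growth_excess d x)"
    using n T by simp
  then have "restrict_bound (Suc (Suc d)) (n + growth_excess (Suc d) n)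
      = (N choose Suc (Suc d)) + restrict_bound (Suc d) (x + growth_excess d x)"
    using restrict_bound_step[OF growth_excess_bounds(2)[OF x]] by simp
  also have "restrict_bound (Suc d) (x + growth_excess d x) = growth_excess d x"
    using x by (intro Suc.IH) auto
  finally show ?case using T by simp
qed simp

text \<open>
  Maximal growth is undone by the downward shift.
\<close>

lemma rank_bound_growth: "1 \<le> d \<Longrightarrow> rank_bound (Suc d) (n + growth_excess d n) = n"
  using restrict_bound_growth[of d n] by (simp add: rank_bound_def)

text \<open>
  The excess $\sum_t \binom{n_t}{t+1}$ is, up to vanishing terms, its own expansion in degree
  \<open>d + 1\<close>, with the same entries moved up one place; shifting it down gives
  $\sum_t \binom{n_t - 1}{t}$.
\<close>

lemma rank_bound_growth_excess: "rank_bound (Suc d) (growth_excess d n) = restrict_bound d n"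
proof -
  have "restrict_bound (Suc d) (growth_excess d n) + restrict_bound d n = growth_excess d n"
  proof (induction d arbitrary: n)
    case (Suc d)
    obtain N x where n: "n = (N choose Suc d) + x" and x: "x < N choose d"
      by (rule greedy_decomposition)
    have T: "growth_excess (Suc d) n = (N choose Suc (Suc d)) + growth_excess d x"
      unfolding n by (rule growth_excess_step[OF x])
    have "restrict_bound (Suc (Suc d)) (growth_excess (Suc d) n)
        = ((N - 1) choose Suc (Suc d)) + restrict_bound (Suc d) (growth_excess d x)"
      unfolding T using growth_excess_bounds(1)[OF x] by (intro restrict_bound_step_le) auto
    moreover have "restrict_bound (Suc d) n = ((N - 1) choose Suc d) + restrict_bound d x"
      unfolding n by (rule restrict_bound_step[OF x])
    moreover have "N choose Suc (Suc d) = ((N - 1) choose Suc d) + ((N - 1) choose Suc (Suc d))"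
      by (cases N) simp_all
    ultimately show ?case using Suc.IH[of x] T by simp
  qed simp
  then show ?thesis by (simp add: rank_bound_def)
qed

text \<open>
  In any binomial expansion the lower terms sum to less than the next step of the top term, so
  every expansion is the greedy one.
\<close>

lemma binomial_expansion_Suc:
  assumes "is_binomial_expansion n (Suc i) j c"
  obtains x where "n = (c (Suc i) choose Suc i) + x" "x < c (Suc i) choose i"
    "x = 0 \<and> j = Suc i \<or> is_binomial_expansion x i j c"
proof -
  have less: "(\<Sum>t = j..k. c t choose t) < Suc (c k) choose k"
    if "is_binomial_expansion m k j c" for m k
    using that
  proof (induction k arbitrary: m)
    case 0
    then show ?case by (auto simp: is_binomial_expansion_def)
  next
    case (Suc k)
    note e = Suc.prems[unfolded is_binomial_expansion_def]
    show ?case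
    proof (cases "j = Suc k")
      case True
      then show ?thesis using e by simp
    next
      case False
      with e have jk: "j \<le> k" by simp
      have lt: "c k < c (Suc k)" using e jk by (auto intro!: strict_mono_onD[of "{j..Suc k}" c])
      have "is_binomial_expansion (\<Sum>t = j..k. c t choose t) k j c"
        using e jk by (auto simp: is_binomial_expansion_def intro: monotone_on_subset)
      from Suc.IH[OF this] have "(\<Sum>t = j..k. c t choose t) < Suc (c k) choose k" .
      also have "\<dots> \<le> c (Suc k) choose k" using lt by (intro binomial_right_mono) simp
      finally show ?thesis using jk by simp
    qed
  qed
  note e = assms[unfolded is_binomial_expansion_def]
  show ?thesis
  proof (cases "j = Suc i")
    case True
    then show ?thesis using e by (intro that[of 0]) auto
  next
    case False
    with e have ji: "j \<le> i" by simp
    let ?x = "\<Sum>t = j..i. c t choose t"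
    have lt: "c i < c (Suc i)" using e ji by (auto intro!: strict_mono_onD[of "{j..Suc i}" c])
    have x: "is_binomial_expansion ?x i j c"
      using e ji by (auto simp: is_binomial_expansion_def intro: monotone_on_subset)
    have "?x < Suc (c i) choose i" by (rule less[OF x])
    also have "\<dots> \<le> c (Suc i) choose i" using lt by (intro binomial_right_mono) simp
    finally show ?thesis using x e ji by (intro that[of ?x]) auto
  qed
qed

text \<open>
  The hypothesis on \<open>f\<close> makes the padding entries \<open>t - 1\<close> below the last index \<open>j\<close> contribute
  nothing.
\<close>

lemma expansion_sum_binomial_expansion:
  assumes f: "\<And>t. f t (Suc t) = 0" and e: "is_binomial_expansion n i j c"
  shows "(\<Sum>t = j..i. f (c t) t) = expansion_sum f i n"
  using e
proof (induction i arbitrary: n)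
  case 0
  then show ?case by (simp add: is_binomial_expansion_def)
next
  case (Suc i)
  have zero: "expansion_sum f d 0 = 0" for d
  proof (induction d)
    case (Suc d)
    then show ?case
      using expansion_sum_step[of 0 d d f] f
      by (simp add: binomial_eq_0 del: expansion_sum.simps)
  qed simp
  obtain x where n: "n = (c (Suc i) choose Suc i) + x" and x: "x < c (Suc i) choose i"
    and cases: "x = 0 \<and> j = Suc i \<or> is_binomial_expansion x i j c"
    by (rule binomial_expansion_Suc[OF Suc.prems])
  have "expansion_sum f (Suc i) n = f (c (Suc i)) (Suc i) + expansion_sum f i x"
    unfolding n by (rule expansion_sum_step[OF x])
  moreover have "(\<Sum>t = j..Suc i. f (c t) t) = f (c (Suc i)) (Suc i) + expansion_sum f i x"
    using cases
  proof
    assume "x = 0 \<and> j = Suc i"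
    then show ?thesis by (simp add: zero)
  next
    assume x: "is_binomial_expansion x i j c"
    then have "j \<le> Suc i" by (simp add: is_binomial_expansion_def)
    then show ?thesis using Suc.IH[OF x] by simp
  qed
  ultimately show ?case by simp
qed

lemma binomial_expansion_exists:
  assumes "1 \<le> n" "1 \<le> i" shows "\<exists>j c. is_binomial_expansion n i j c"
  using assms
proof (induction i arbitrary: n)
  case (Suc i)
  obtain N x where n: "n = (N choose Suc i) + x" and x: "x < N choose i"
    by (rule greedy_decomposition)
  have N: "Suc i \<le> N"
  proof (rule ccontr)
    assume "\<not> Suc i \<le> N"
    then have "N \<le> i" by simp
    then have "N choose i \<le> i choose i" by (rule binomial_right_mono)
    with x n Suc.prems \<open>N \<le> i\<close> show False by (simp add: binomial_eq_0)
  qed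
  show ?case
  proof (cases "x = 0")
    case True
    then have "is_binomial_expansion n (Suc i) (Suc i) (\<lambda>_. N)"
      using n N by (auto simp: is_binomial_expansion_def strict_mono_on_def)
    then show ?thesis by blast
  next
    case False
    with x have "1 \<le> i" by (cases i) auto
    then obtain j c where e: "is_binomial_expansion x i j c" using Suc.IH[of x] False by auto
    note e' = e[unfolded is_binomial_expansion_def]
    have "c i choose i \<le> x" using e' by (simp add: sum.remove[of "{j..i}" i])
    have "c i < N"
    proof (rule ccontr)
      assume "\<not> c i < N"
      then have "N choose i \<le> c i choose i" by (intro binomial_right_mono) simp
      with \<open>c i choose i \<le> x\<close> x show False by simp
    qed
    have le: "c t \<le> c i" if "t \<in> {j..i}" for t
      using that e' strict_mono_onD[of "{j..i}" c t i] by (cases "t = i") auto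
    have "strict_mono_on {j..Suc i} (c(Suc i := N))"
    proof (rule strict_mono_onI)
      fix s t assume st: "s \<in> {j..Suc i}" "t \<in> {j..Suc i}" "s < t"
      show "(c(Suc i := N)) s < (c(Suc i := N)) t"
      proof (cases "t = Suc i")
        case True
        then show ?thesis using st le[of s] \<open>c i < N\<close> by auto
      next
        case False
        then show ?thesis using st e' strict_mono_onD[of "{j..i}" c s t] by auto
      qed
    qed
    moreover have "(\<Sum>t = j..Suc i. (c(Suc i := N)) t choose t) = n"
      using n e' by (simp add: add.commute)
    ultimately have "is_binomial_expansion n (Suc i) j (c(Suc i := N))"
      using e' by (auto simp: is_binomial_expansion_def)
    then show ?thesis by blast
  qed
qed simp

lemma binomial_expansion_entry_ge:
  assumes e: "is_binomial_expansion n i j c" and t: "t \<in> {j..i}"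
  shows "t \<le> c t"
proof -
  from t have "j \<le> t" "t \<le> i" by auto
  then show ?thesis
  proof (induction t rule: dec_induct)
    case base
    then show ?case using e by (simp add: is_binomial_expansion_def)
  next
    case (step t)
    then have "c t < c (Suc t)"
      using e by (auto simp: is_binomial_expansion_def intro!: strict_mono_onD[of "{j..i}" c])
    with step show ?case by simp
  qed
qed

lemma binomial_shift_eqI:
  assumes "1 \<le> n" "1 \<le> i"
    and "\<And>j c. is_binomial_expansion n i j c \<Longrightarrow>
      (\<Sum>t = j..i. int_choose (int (c t) + a) (int t + a)) = v"
  shows "binomial_shift n i a = v"
proof -
  obtain j c where "is_binomial_expansion n i j c" using binomial_expansion_exists assms by blast
  with assms(3) have "(THE v. \<exists>j c. is_binomial_expansion n i j c \<and>
      v = (\<Sum>t = j..i. int_choose (int (c t) + a) (int t + a))) = v"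
    by (intro the_equality) auto
  then show ?thesis using assms(1) by (simp add: binomial_shift_def)
qed

lemma binomial_shift_down:
  assumes "1 \<le> i" shows "binomial_shift n i (-1) = rank_bound i n"
proof (cases "n = 0")
  case False
  show ?thesis
  proof (rule binomial_shift_eqI)
    fix j c assume e: "is_binomial_expansion n i j c"
    have "(\<Sum>t = j..i. int_choose (int (c t) + -1) (int t + -1))
        + (\<Sum>t = j..i. (c t - 1) choose t) = (\<Sum>t = j..i. c t choose t)"
      unfolding sum.distrib[symmetric]
    proof (rule sum.cong[OF refl])
      fix t assume t: "t \<in> {j..i}"
      have "1 \<le> t" using t e by (auto simp: is_binomial_expansion_def)
      then obtain s where s: "t = Suc s" by (cases t) auto
      moreover have "t \<le> c t" by (rule binomial_expansion_entry_ge[OF e t])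
      ultimately obtain m where m: "c (Suc s) = Suc m" by (cases "c t") auto
      show "int_choose (int (c t) + - 1) (int t + - 1) + (c t - 1 choose t) = c t choose t"
        unfolding s m by (simp add: int_choose_def)
    qed
    also have "(\<Sum>t = j..i. (c t - 1) choose t) = restrict_bound i n"
      unfolding restrict_bound_def by (rule expansion_sum_binomial_expansion[OF _ e]) simp
    also have "(\<Sum>t = j..i. c t choose t) = n" using e by (simp add: is_binomial_expansion_def)
    finally show "(\<Sum>t = j..i. int_choose (int (c t) + - 1) (int t + - 1)) = rank_bound i n"
      by (simp add: rank_bound_def)
  qed (use False assms in auto)
qed (simp add: binomial_shift_def)

lemma growth_excess_0 [simp]: "growth_excess d 0 = 0"
proof (induction d)
  case (Suc d)
  then show ?case using growth_excess_step[of 0 d d] by (simp add: binomial_eq_0)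
qed simp

lemma binomial_shift_up:
  assumes "1 \<le> i" shows "binomial_shift n i 1 = n + growth_excess i n"
proof (cases "n = 0")
  case False
  show ?thesis
  proof (rule binomial_shift_eqI)
    fix j c assume e: "is_binomial_expansion n i j c"
    have "(\<Sum>t = j..i. int_choose (int (c t) + 1) (int t + 1))
        = (\<Sum>t = j..i. c t choose t) + (\<Sum>t = j..i. c t choose Suc t)"
      unfolding sum.distrib[symmetric]
      by (rule sum.cong) (simp_all add: int_choose_def nat_add_distrib)
    also have "(\<Sum>t = j..i. c t choose Suc t) = growth_excess i n"
      unfolding growth_excess_def by (rule expansion_sum_binomial_expansion[OF _ e]) simp
    also have "(\<Sum>t = j..i. c t choose t) = n" using e by (simp add: is_binomial_expansion_def)
    finally show "(\<Sum>t = j..i. int_choose (int (c t) + 1) (int t + 1)) = n + growth_excess i n" .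
  qed (use False assms in auto)
qed (simp add: binomial_shift_def)

section \<open>Dimensions of finitely spanned subspaces\<close>

context vector_space
begin

lemma finite_if_independent:
  assumes "finite X" "V \<subseteq> span X" "independent B" "B \<subseteq> V"
  shows "finite B"
  using independent_span_bound[OF assms(1,3)] assms(2,4) by blast

lemma card_independent_le_dim:
  assumes V: "finite X" "V \<subseteq> span X" and B: "independent B" "B \<subseteq> V"
  shows "card B \<le> dim V"
proof -
  obtain C where C: "B \<subseteq> C" "C \<subseteq> V" "independent C" "V \<subseteq> span C"
    using maximal_independent_subset_extend[OF B(2,1)] .
  have "card B \<le> card C" using finite_if_independent[OF V C(3,2)] C(1) by (rule card_mono)
  then show ?thesis using basis_card_eq_dim[OF C(2,4,3)] by simp
qed

lemma dim_mono_finitely_spanned: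
  assumes "finite X" "W \<subseteq> span X" "V \<subseteq> W" shows "dim V \<le> dim W"
proof -
  obtain B where "B \<subseteq> V" "independent B" "V \<subseteq> span B" "card B = dim V" by (rule basis_exists)
  then show ?thesis using card_independent_le_dim[OF assms(1,2), of B] assms(3) by auto
qed

lemma subspace_eq_if_dim_le:
  assumes W: "finite X" "W \<subseteq> span X" and V: "subspace V" "V \<subseteq> W" and le: "dim W \<le> dim V"
  shows "V = W"
proof (rule subset_antisym[OF V(2)])
  obtain B where B: "B \<subseteq> V" "independent B" "V \<subseteq> span B" "card B = dim V" by (rule basis_exists)
  obtain C where C: "B \<subseteq> C" "C \<subseteq> W" "independent C" "W \<subseteq> span C"
    using maximal_independent_subset_extend[of B W] B V by blast
  have fin: "finite C" by (rule finite_if_independent[OF W C(3,2)])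
  have "card C \<le> card B" using basis_card_eq_dim[OF C(2,4,3)] B(4) le by simp
  with C(1) fin have "B = C" by (metis card_seteq)
  then show "W \<subseteq> V" using C(4) span_minimal[OF B(1) V(1)] by blast
qed

text \<open>
  Rank-nullity for the map \<open>A \<rightarrow> U / V\<close> induced by \<open>f\<close> on the ambient space \<open>U\<close>, expressed
  through subspaces so that no quotient spaces are needed: a basis of the preimage of \<open>V\<close> is extended
  to \<open>A\<close>, and the images of the new vectors are independent modulo \<open>V\<close>.
\<close>

lemma dim_sum_plus_dim_preimage:
  assumes lin: "Vector_Spaces.linear scale scale f"
    and A: "subspace A" "finite X" "A \<subseteq> span X"
    and V: "subspace V" "finite Y" "V \<subseteq> span Y"
  shows "dim {v + f a | v a. v \<in> V \<and> a \<in> A} + dim {a \<in> A. f a \<in> V} = dim V + dim A"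
proof -
  interpret f: Vector_Spaces.linear scale scale f by (rule lin)
  let ?W = "{a \<in> A. f a \<in> V}"
  let ?S = "{v + f a | v a. v \<in> V \<and> a \<in> A}"
  have W: "subspace ?W"
    using A(1) V(1) by (auto simp: subspace_def f.add f.scale f.zero)
  obtain BW where BW: "BW \<subseteq> ?W" "independent BW" "?W \<subseteq> span BW" "card BW = dim ?W"
    by (rule basis_exists)
  have "BW \<subseteq> A" using BW(1) by blast
  obtain B where B: "BW \<subseteq> B" "B \<subseteq> A" "independent B" "A \<subseteq> span B"
    using maximal_independent_subset_extend[OF \<open>BW \<subseteq> A\<close> BW(2)] .
  have finB: "finite B" by (rule finite_if_independent[OF A(2,3) B(3,2)])
  have cardB: "card B = dim A" by (rule basis_card_eq_dim[OF B(2,4,3)])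
  obtain BV where BV: "BV \<subseteq> V" "independent BV" "V \<subseteq> span BV" "card BV = dim V"
    by (rule basis_exists)
  have finBV: "finite BV" by (rule finite_if_independent[OF V(2,3) BV(2,1)])
  have spanBV: "span BV = V" using BV(1,3) span_minimal[OF BV(1) V(1)] by blast
  have spanBW: "span BW = ?W" using BW(1,3) span_minimal[OF BW(1) W] by blast
  have spanB: "span B = A" using B(2,4) span_minimal[OF B(2) A(1)] by blast
  have indep: "independent (BV \<union> f ` C) \<and> card (BV \<union> f ` C) = card BV + card C"
    if "finite C" "C \<subseteq> B - BW" for C
    using that
  proof (induction C)
    case empty
    then show ?case using BV(2) by simp
  next
    case (insert c C)
    have new: "f c \<notin> span (BV \<union> f ` C)"
    proof
      assume "f c \<in> span (BV \<union> f ` C)"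
      then obtain v w where vw: "v \<in> V" "w \<in> span (f ` C)" "f c = v + w"
        unfolding span_Un spanBV by auto
      then obtain y where y: "y \<in> span C" "w = f y" using f.span_image by auto
      have "y \<in> A" using y(1) insert.prems B(2) span_mono[of C B] spanB by blast
      moreover have "c \<in> A" using insert.prems B(2) by blast
      moreover have "f (c - y) = v" using vw y by (simp add: f.diff)
      ultimately have "c - y \<in> span BW" unfolding spanBW using vw(1) A(1) by (auto intro: subspace_diff)
      then have "(c - y) + y \<in> span (B - {c})"
        using y(1) insert.hyps insert.prems B(1) span_mono[of BW "B - {c}"] span_mono[of C "B - {c}"]
        by (intro span_add) blast+
      then show False using B(3) insert.prems unfolding dependent_def by auto
    qed
    have IH: "independent (BV \<union> f ` C)" "card (BV \<union> f ` C) = card BV + card C"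
      using insert.IH insert.prems by auto
    have eq: "BV \<union> f ` insert c C = insert (f c) (BV \<union> f ` C)" by simp
    have "f c \<notin> BV \<union> f ` C" using new span_base[of "f c" "BV \<union> f ` C"] by metis
    then have "card (insert (f c) (BV \<union> f ` C)) = card BV + card (insert c C)"
      using IH(2) insert.hyps finBV by simp
    then show ?case unfolding eq using independent_insertI[OF new IH(1)] by simp
  qed
  have finC: "finite (B - BW)" using finB by simp
  note indep = indep[OF finC subset_refl]
  have "BV \<union> f ` (B - BW) \<subseteq> ?S"
  proof
    fix x assume "x \<in> BV \<union> f ` (B - BW)"
    then show "x \<in> ?S"
    proof
      assume "x \<in> BV"
      then have "x = x + f 0 \<and> x \<in> V \<and> 0 \<in> A" using BV(1) A(1) by (auto simp: f.zero subspace_0)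
      then show ?thesis by blast
    next
      assume "x \<in> f ` (B - BW)"
      then obtain b where "x = 0 + f b \<and> 0 \<in> V \<and> b \<in> A" using B(2) V(1) by (auto simp: subspace_0)
      then show ?thesis by blast
    qed
  qed
  moreover have "?S \<subseteq> span (BV \<union> f ` (B - BW))"
  proof
    fix x assume "x \<in> ?S"
    then obtain v a where x: "x = v + f a" "v \<in> V" "a \<in> A" by blast
    have "a \<in> span (BW \<union> (B - BW))" using x(3) spanB B(1) by (simp add: Un_absorb1)
    then obtain p q where pq: "p \<in> ?W" "q \<in> span (B - BW)" "a = p + q"
      unfolding span_Un spanBW by auto
    have "f q \<in> span (f ` (B - BW))" using pq(2) f.span_image by auto
    moreover have "v + f p \<in> span BV" unfolding spanBV using x(2) pq(1) V(1) by (auto intro: subspace_add)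
    ultimately have "(v + f p) + f q \<in> span (BV \<union> f ` (B - BW))"
      by (auto simp: span_Un)
    then show "x \<in> span (BV \<union> f ` (B - BW))" using x(1) pq(3) by (simp add: f.add add.assoc)
  qed
  ultimately have "dim ?S = card BV + card (B - BW)"
    using indep by (intro dim_unique) auto
  moreover have "card (B - BW) + card BW = card B"
    using B(1) finB by (metis card_Diff_subset card_mono finite_subset le_add_diff_inverse2)
  ultimately show ?thesis using BW(4) BV(4) cardB by simp
qed

lemma card_family_le_dim:
  assumes X: "finite X" "V \<subseteq> span X"
    and g: "\<And>i. i < n \<Longrightarrow> g i \<in> V"
    and indep: "\<And>c. (\<Sum>i<n. scale (c i) (g i)) = 0 \<Longrightarrow> \<forall>i<n. c i = 0"
  shows "n \<le> dim V"
proof -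
  have inj: "inj_on g {..<n}"
  proof (rule inj_onI, rule ccontr)
    fix i j assume ij: "i \<in> {..<n}" "j \<in> {..<n}" "g i = g j" "i \<noteq> j"
    let ?c = "\<lambda>l. if l = i then 1 :: 'a else if l = j then - 1 else 0"
    have "(\<Sum>l<n. scale (?c l) (g l)) = (\<Sum>l\<in>{i, j}. scale (?c l) (g l))"
      using ij by (intro sum.mono_neutral_right) auto
    also have "\<dots> = 0" using ij by simp
    finally have "\<forall>l<n. ?c l = 0" by (rule indep)
    then show False using ij by auto
  qed
  have "independent (g ` {..<n})"
  proof (rule independent_if_scalars_zero)
    fix f x assume sum: "(\<Sum>x\<in>g ` {..<n}. scale (f x) x) = 0" and x: "x \<in> g ` {..<n}"
    have "(\<Sum>i<n. scale (f (g i)) (g i)) = 0" using sum by (simp add: sum.reindex[OF inj])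
    then have "\<forall>i<n. f (g i) = 0" by (rule indep)
    then show "f x = 0" using x by auto
  qed simp
  then have "card (g ` {..<n}) \<le> dim V" using g by (intro card_independent_le_dim[OF X]) auto
  then show ?thesis by (simp add: card_image[OF inj])
qed

end

section \<open>Independence along a line\<close>

text \<open>
  Independence of finitely many vectors with polynomial entries is an open condition on the
  parameter. Gaussian elimination over the polynomial ring, with a pivot that does not vanish at the
  given point, reduces \<open>n + 1\<close> vectors to \<open>n\<close>; only the finitely many roots of the pivot are lost.
\<close>

lemma cofinite_independent:
  fixes w :: "nat \<Rightarrow> 'x \<Rightarrow> 'k :: field poly"
  assumes "\<And>c. (\<And>x. (\<Sum>i<n. c i * poly (w i x) t\<^sub>0) = 0) \<Longrightarrow> \<forall>i<n. c i = 0"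
  shows "finite {t. \<exists>c. (\<forall>x. (\<Sum>i<n. c i * poly (w i x) t) = 0) \<and> (\<exists>i<n. c i \<noteq> 0)}"
  using assms
proof (induction n arbitrary: w)
  case (Suc n)
  have "\<exists>x. poly (w n x) t\<^sub>0 \<noteq> 0"
  proof (rule ccontr)
    assume "\<nexists>x. poly (w n x) t\<^sub>0 \<noteq> 0"
    then have "\<forall>i<Suc n. (if i = n then 1 else 0 :: 'k) = 0"
      by (intro Suc.prems) (auto intro!: sum.neutral)
    then show False by auto
  qed
  then obtain x\<^sub>0 where x0: "poly (w n x\<^sub>0) t\<^sub>0 \<noteq> 0" ..
  let ?p = "w n x\<^sub>0"
  \<comment> \<open>Eliminate the coordinate \<open>x\<^sub>0\<close> with pivot \<open>w n x\<^sub>0\<close>.\<close>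
  define w' where "w' i x = ?p * w i x - w i x\<^sub>0 * w n x" for i x
  \<comment> \<open>A relation among the reduced vectors is a relation among the original ones.\<close>
  have eq: "(\<Sum>i<n. c i * poly (w' i x) t)
      = (\<Sum>i<Suc n. (if i = n then - (\<Sum>j<n. c j * poly (w j x\<^sub>0) t) else poly ?p t * c i) * poly (w i x) t)"
    for c x t
    by (simp add: w'_def algebra_simps sum_subtractf sum_distrib_left sum_distrib_right)
  have "finite {t. \<exists>c. (\<forall>x. (\<Sum>i<n. c i * poly (w' i x) t) = 0) \<and> (\<exists>i<n. c i \<noteq> 0)}"
  proof (rule Suc.IH)
    fix c assume "\<And>x. (\<Sum>i<n. c i * poly (w' i x) t\<^sub>0) = 0"
    then have "\<forall>i<Suc n. (if i = n then - (\<Sum>j<n. c j * poly (w j x\<^sub>0) t\<^sub>0) else poly ?p t\<^sub>0 * c i) = 0"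
      unfolding eq by (rule Suc.prems)
    then have "poly ?p t\<^sub>0 * c i = 0" if "i < n" for i
      using that by (metis less_SucI less_irrefl)
    then show "\<forall>i<n. c i = 0" using x0 by auto
  qed
  moreover have "finite {t. poly ?p t = 0}" using x0 by (intro poly_roots_finite) auto
  moreover have "{t. \<exists>c. (\<forall>x. (\<Sum>i<Suc n. c i * poly (w i x) t) = 0) \<and> (\<exists>i<Suc n. c i \<noteq> 0)}
      \<subseteq> {t. \<exists>c. (\<forall>x. (\<Sum>i<n. c i * poly (w' i x) t) = 0) \<and> (\<exists>i<n. c i \<noteq> 0)} \<union> {t. poly ?p t = 0}"
  proof
    fix t assume "t \<in> {t. \<exists>c. (\<forall>x. (\<Sum>i<Suc n. c i * poly (w i x) t) = 0) \<and> (\<exists>i<Suc n. c i \<noteq> 0)}"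
    then obtain c where c: "\<And>x. (\<Sum>i<Suc n. c i * poly (w i x) t) = 0" "\<exists>i<Suc n. c i \<noteq> 0" by blast
    show "t \<in> {t. \<exists>c. (\<forall>x. (\<Sum>i<n. c i * poly (w' i x) t) = 0) \<and> (\<exists>i<n. c i \<noteq> 0)} \<union> {t. poly ?p t = 0}"
    proof (cases "poly ?p t = 0")
      case False
      have sum_x0: "(\<Sum>j<n. c j * poly (w j x\<^sub>0) t) = - (c n * poly ?p t)"
        using c(1)[of x\<^sub>0] by (simp add: eq_neg_iff_add_eq_0)
      have "(\<Sum>i<n. c i * poly (w' i x) t) = poly ?p t * (\<Sum>i<Suc n. c i * poly (w i x) t)" for x
        unfolding eq sum_x0 by (simp add: algebra_simps sum_distrib_left)
      then have "\<forall>x. (\<Sum>i<n. c i * poly (w' i x) t) = 0" using c(1) by simp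
      moreover have "\<exists>i<n. c i \<noteq> 0"
      proof (rule ccontr)
        assume "\<not> (\<exists>i<n. c i \<noteq> 0)"
        then have "c n * poly ?p t = 0" using sum_x0 by simp
        with False c(2) \<open>\<not> (\<exists>i<n. c i \<noteq> 0)\<close> show False by (auto simp: less_Suc_eq)
      qed
      ultimately show ?thesis by blast
    qed simp
  qed
  ultimately show ?case by (meson finite_UnI finite_subset)
qed simp

section \<open>Forms\<close>

lemma poly_const_add: "poly_const (a + b) = poly_const a + poly_const b"
  by (simp add: poly_const_def single_add)

lemma poly_const_mult: "poly_const (a * b) = poly_const a * poly_const b"
  by (simp add: poly_const_def mult_single)

lemma poly_const_1 [simp]: "poly_const 1 = 1"
  by (simp add: poly_const_def)

lemma poly_const_0 [simp]: "poly_const 0 = 0"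
  by (simp add: poly_const_def)

interpretation poly_space: vector_space "\<lambda>c p. poly_const c * (p :: 'k::field mpoly)"
  by unfold_locales (simp_all add: algebra_simps poly_const_add poly_const_mult)

lemma lookup_poly_const_mult: "Poly_Mapping.lookup (poly_const c * p) m = c * Poly_Mapping.lookup p m"
  unfolding poly_const_def mult_map_scale_conv_mult[symmetric]
  by (simp add: map.rep_eq when_def)

lemma sum_monomials: "p = (\<Sum>m\<in>Poly_Mapping.keys p. Poly_Mapping.single m (Poly_Mapping.lookup p m))"
  by (rule poly_mapping_eqI) (simp add: lookup_sum lookup_single when_def in_keys_iff)

lemma mdeg_eq_sum:
  "finite A \<Longrightarrow> Poly_Mapping.keys m \<subseteq> A \<Longrightarrow> mdeg m = (\<Sum>i\<in>A. Poly_Mapping.lookup m i)"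
  unfolding mdeg_def by (rule sum.mono_neutral_left) (auto simp: in_keys_iff)

lemma mdeg_add: "mdeg (m + n) = mdeg m + mdeg n"
proof -
  let ?A = "Poly_Mapping.keys m \<union> Poly_Mapping.keys n"
  have "mdeg (m + n) = (\<Sum>i\<in>?A. Poly_Mapping.lookup (m + n) i)"
    using Poly_Mapping.keys_add[of m n] by (intro mdeg_eq_sum) auto
  moreover have "mdeg m = (\<Sum>i\<in>?A. Poly_Mapping.lookup m i)" "mdeg n = (\<Sum>i\<in>?A. Poly_Mapping.lookup n i)"
    by (intro mdeg_eq_sum; auto)+
  ultimately show ?thesis by (simp add: lookup_add sum.distrib)
qed

lemma mdeg_eq_0_iff: "mdeg m = 0 \<longleftrightarrow> m = 0"
  unfolding mdeg_def by (auto simp: in_keys_iff intro!: poly_mapping_eqI)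

lemma mdeg_single: "mdeg (Poly_Mapping.single i n) = n"
  by (simp add: mdeg_def)

lemma forms_iff:
  "p \<in> forms r d \<longleftrightarrow> (\<forall>m \<in> Poly_Mapping.keys p. Poly_Mapping.keys m \<subseteq> {..<r} \<and> mdeg m = d)"
  by (auto simp: forms_def poly_ring_def)

lemma forms_mult:
  assumes "p \<in> forms r a" "q \<in> forms r b" shows "p * q \<in> forms r (a + b)"
  unfolding forms_iff
proof
  fix m assume "m \<in> Poly_Mapping.keys (p * q)"
  then obtain m1 m2 where "m = m1 + m2" "m1 \<in> Poly_Mapping.keys p" "m2 \<in> Poly_Mapping.keys q"
    using keys_mult[of p q] by auto
  then show "Poly_Mapping.keys m \<subseteq> {..<r} \<and> mdeg m = a + b"
    using assms Poly_Mapping.keys_add[of m1 m2] unfolding forms_iff mdeg_add by (simp add: mdeg_add) blast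
qed

lemma forms_mult_linear: "l \<in> forms r 1 \<Longrightarrow> p \<in> forms r d \<Longrightarrow> l * p \<in> forms r (Suc d)"
  using forms_mult[of l r 1 p d] by simp

lemma poly_const_in_forms: "poly_const c \<in> forms r 0"
  by (auto simp: forms_iff poly_const_def mdeg_eq_0_iff split: if_splits)

lemma poly_var_in_forms: "i < r \<Longrightarrow> poly_var i \<in> forms r 1"
  by (auto simp: forms_iff poly_var_def mdeg_single)

lemma subspace_forms: "poly_space.subspace (forms r d)"
  unfolding poly_space.subspace_def
proof (intro conjI ballI allI)
  fix p q :: "'a mpoly" assume "p \<in> forms r d" "q \<in> forms r d"
  then show "p + q \<in> forms r d" using Poly_Mapping.keys_add[of p q] unfolding forms_iff by blast
next
  fix c and p :: "'a mpoly" assume "p \<in> forms r d"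
  then show "poly_const c * p \<in> forms r d"
    using forms_mult[OF poly_const_in_forms, of p r d c] by simp
qed (simp add: forms_iff)

lemma forms_finitely_spanned:
  obtains X :: "'k::field mpoly set" where "finite X" "forms r d \<subseteq> poly_space.span X"
proof
  let ?M = "{m. Poly_Mapping.keys m \<subseteq> {..<r} \<and> mdeg m = d}"
  let ?X = "(\<lambda>m. Poly_Mapping.single m 1) ` ?M :: 'k mpoly set"
  have "finite ((\<lambda>m. restrict (Poly_Mapping.lookup m) {..<r}) ` ?M)"
  proof (rule finite_subset)
    show "(\<lambda>m. restrict (Poly_Mapping.lookup m) {..<r}) ` ?M \<subseteq> PiE {..<r} (\<lambda>_. {..d})"
    proof clarify
      fix m :: "nat \<Rightarrow>\<^sub>0 nat" assume m: "Poly_Mapping.keys m \<subseteq> {..<r}"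
      have "Poly_Mapping.lookup m i \<le> mdeg m" if "i < r" for i
        using that m by (simp add: mdeg_eq_sum[of "{..<r}"] member_le_sum)
      then show "restrict (Poly_Mapping.lookup m) {..<r} \<in> {..<r} \<rightarrow>\<^sub>E {..mdeg m}" by auto
    qed
  qed (simp add: finite_PiE)
  moreover have "inj_on (\<lambda>m. restrict (Poly_Mapping.lookup m) {..<r}) ?M"
  proof (rule inj_onI, rule poly_mapping_eqI)
    fix m n :: "nat \<Rightarrow>\<^sub>0 nat" and i
    assume mn: "m \<in> ?M" "n \<in> ?M" and eq: "restrict (Poly_Mapping.lookup m) {..<r} = restrict (Poly_Mapping.lookup n) {..<r}"
    show "Poly_Mapping.lookup m i = Poly_Mapping.lookup n i"
    proof (cases "i < r")
      case True
      then show ?thesis using fun_cong[OF eq, of i] by simp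
    next
      case False
      then have "i \<notin> Poly_Mapping.keys m" "i \<notin> Poly_Mapping.keys n" using mn by auto
      then show ?thesis by (simp add: in_keys_iff)
    qed
  qed
  ultimately show "finite ?X" by (auto dest: finite_imageD)
  show "forms r d \<subseteq> poly_space.span ?X"
  proof
    fix p :: "'k mpoly" assume p: "p \<in> forms r d"
    have "(\<Sum>m\<in>Poly_Mapping.keys p. poly_const (Poly_Mapping.lookup p m) * Poly_Mapping.single m 1)
        \<in> poly_space.span ?X"
      using p by (intro poly_space.span_sum poly_space.span_scale poly_space.span_base)
        (auto simp: forms_iff)
    also have "(\<Sum>m\<in>Poly_Mapping.keys p. poly_const (Poly_Mapping.lookup p m) * Poly_Mapping.single m 1) = p"
      using sum_monomials[of p] by (simp add: poly_const_def mult_single)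
    finally show "p \<in> poly_space.span ?X" .
  qed
qed

text \<open>
  $R_{d+1}$ is spanned by the products of the variables with forms of degree \<open>d\<close>.
\<close>

lemma forms_Suc_subset:
  assumes V: "poly_space.subspace V"
    and vars: "\<And>i p. i < r \<Longrightarrow> p \<in> forms r d \<Longrightarrow> poly_var i * p \<in> V"
  shows "forms r (Suc d) \<subseteq> V"
proof
  fix p :: "'a mpoly" assume p: "p \<in> forms r (Suc d)"
  have "Poly_Mapping.single m (Poly_Mapping.lookup p m) \<in> V" if m: "m \<in> Poly_Mapping.keys p" for m
  proof -
    have deg: "Poly_Mapping.keys m \<subseteq> {..<r}" "mdeg m = Suc d" using p m by (auto simp: forms_iff)
    then obtain i where i: "i \<in> Poly_Mapping.keys m"
      by (metis all_not_in_conv mdeg_def nat.distinct(1) sum.empty)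
    define n where "n = m - Poly_Mapping.single i 1"
    have m_eq: "m = Poly_Mapping.single i 1 + n"
      unfolding n_def using i
      by (intro poly_mapping_eqI) (auto simp: lookup_add lookup_minus lookup_single when_def in_keys_iff)
    have "Poly_Mapping.keys n \<subseteq> Poly_Mapping.keys m"
      using m_eq by (auto simp: in_keys_iff lookup_add)
    moreover have "mdeg n = d" using deg(2) unfolding m_eq by (simp add: mdeg_add mdeg_single)
    ultimately have "Poly_Mapping.single n (Poly_Mapping.lookup p m) \<in> forms r d"
      using deg(1) by (auto simp: forms_iff split: if_splits)
    moreover have "i < r" using i deg(1) by auto
    ultimately have "poly_var i * Poly_Mapping.single n (Poly_Mapping.lookup p m) \<in> V" by (intro vars)
    moreover have "poly_var i * Poly_Mapping.single n c = Poly_Mapping.single m c" for c :: 'a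
      unfolding m_eq by (simp add: poly_var_def mult_single)
    ultimately show ?thesis by simp
  qed
  then have "(\<Sum>m\<in>Poly_Mapping.keys p. Poly_Mapping.single m (Poly_Mapping.lookup p m)) \<in> V"
    by (intro poly_space.subspace_sum[OF V])
  then show "p \<in> V" using sum_monomials[of p] by simp
qed

lemma linear_mult: "Vector_Spaces.linear (\<lambda>c p. poly_const c * p) (\<lambda>c p. poly_const c * p) ((*) (l :: 'k::field mpoly))"
  unfolding Vector_Spaces.linear_iff by (simp add: poly_space.vector_space_axioms distrib_left mult.left_commute)

lemma forms_0_dim_le: "poly_space.dim (forms r 0 :: 'k::field mpoly set) \<le> 1"
proof -
  have "forms r 0 \<subseteq> poly_space.span {1 :: 'k mpoly}"
  proof
    fix p :: "'k mpoly" assume "p \<in> forms r 0"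
    then have "Poly_Mapping.keys p \<subseteq> {0}" by (auto simp: forms_iff mdeg_eq_0_iff)
    then have "p = poly_const (Poly_Mapping.lookup p 0) * 1"
      by (intro poly_mapping_eqI) (auto simp: poly_const_def lookup_single when_def in_keys_iff)
    then show "p \<in> poly_space.span {1}"
      by (metis poly_space.span_base poly_space.span_scale singletonI)
  qed
  from poly_space.dim_le_card[OF this] show ?thesis by simp
qed

section \<open>Generic linear forms\<close>

text \<open>
  For $A = R_d$ this is $V + l R_d$, so the dimension gained over \<open>V\<close> is the rank of multiplication
  by \<open>l\<close> from $R_d$ to $R_{d+1} / V$.
\<close>

definition adjoin_multiples ::
  "'k::field mpoly set \<Rightarrow> 'k mpoly \<Rightarrow> 'k mpoly set \<Rightarrow> 'k mpoly set" where
  "adjoin_multiples V l A = {v + l * a | v a. v \<in> V \<and> a \<in> A}"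

lemma subspace_adjoin_multiples:
  assumes "poly_space.subspace V" "poly_space.subspace A"
  shows "poly_space.subspace (adjoin_multiples V l A)"
proof -
  interpret m: Vector_Spaces.linear "\<lambda>c p. poly_const c * p" "\<lambda>c p. poly_const c * p" "(*) l"
    by (rule linear_mult)
  have "adjoin_multiples V l A = {x + y | x y. x \<in> V \<and> y \<in> (*) l ` A}"
    unfolding adjoin_multiples_def by blast
  then show ?thesis using assms m.subspace_image[of A] poly_space.subspace_sums[of V "(*) l ` A"] by simp
qed

lemma subset_adjoin_multiples:
  assumes "poly_space.subspace A" shows "V \<subseteq> adjoin_multiples V l A"
proof
  fix v assume "v \<in> V"
  then have "v = v + l * 0 \<and> v \<in> V \<and> 0 \<in> A" using assms by (simp add: poly_space.subspace_0)
  then show "v \<in> adjoin_multiples V l A" unfolding adjoin_multiples_def by blast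
qed

lemma multiple_in_adjoin_multiples:
  assumes "poly_space.subspace V" "a \<in> A" shows "l * a \<in> adjoin_multiples V l A"
proof -
  have "l * a = 0 + l * a \<and> 0 \<in> V \<and> a \<in> A" using assms by (simp add: poly_space.subspace_0)
  then show ?thesis unfolding adjoin_multiples_def by blast
qed

lemma adjoin_multiples_subset_forms:
  assumes "V \<subseteq> forms r (Suc d)" "l \<in> forms r 1" "A \<subseteq> forms r d"
  shows "adjoin_multiples V l A \<subseteq> forms r (Suc d)"
  using assms forms_mult_linear[of l r _ d] poly_space.subspace_add[OF subspace_forms]
  unfolding adjoin_multiples_def by blast

lemma dim_mono_forms:
  assumes "W \<subseteq> forms r d" "V \<subseteq> W" shows "poly_space.dim V \<le> poly_space.dim W"
proof -
  obtain X :: "'a mpoly set" where "finite X" "forms r d \<subseteq> poly_space.span X"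
    by (rule forms_finitely_spanned)
  then show ?thesis
    using assms by (intro poly_space.dim_mono_finitely_spanned[of X]) auto
qed

lemma forms_subspace_eqI:
  assumes "W \<subseteq> forms r d" "poly_space.subspace V" "V \<subseteq> W" "poly_space.dim W \<le> poly_space.dim V"
  shows "V = W"
proof -
  obtain X :: "'a mpoly set" where "finite X" "forms r d \<subseteq> poly_space.span X"
    by (rule forms_finitely_spanned)
  then show ?thesis
    using assms by (intro poly_space.subspace_eq_if_dim_le[of X]) auto
qed

lemma dim_adjoin_multiples:
  fixes V :: "'k::field mpoly set"
  assumes "poly_space.subspace V" "V \<subseteq> forms r e"
  shows "poly_space.dim (adjoin_multiples V l (forms r d))
      + poly_space.dim {F \<in> forms r d. l * F \<in> V}
    = poly_space.dim V + poly_space.dim (forms r d :: 'k mpoly set)"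
proof -
  obtain X :: "'k mpoly set" where X: "finite X" "forms r d \<subseteq> poly_space.span X"
    by (rule forms_finitely_spanned)
  obtain Y :: "'k mpoly set" where Y: "finite Y" "forms r e \<subseteq> poly_space.span Y"
    by (rule forms_finitely_spanned)
  have "V \<subseteq> poly_space.span Y" using Y assms by auto
  from poly_space.dim_sum_plus_dim_preimage[OF linear_mult[of l] subspace_forms X assms(1) Y(1) this]
  show ?thesis unfolding adjoin_multiples_def by simp
qed

text \<open>
  A basis of $V + l R_d$ drawn from \<open>V\<close> and the multiples of \<open>l\<close> moves affinely with the linear form, so
  it stays independent, and the dimension does not drop, at all but finitely many points of the line.
\<close>

lemma finite_dim_drops_on_line:
  fixes V :: "'k::field mpoly set"
  assumes V: "poly_space.subspace V" "V \<subseteq> forms r (Suc d)"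
    and a: "a \<in> forms r 1" and b: "b \<in> forms r 1"
  shows "finite {t. poly_space.dim (adjoin_multiples V (a + poly_const t * b) (forms r d))
    < poly_space.dim (adjoin_multiples V (a + poly_const t\<^sub>0 * b) (forms r d))}"
proof -
  define l where "l t = a + poly_const t * b" for t
  define S where "S t = adjoin_multiples V (l t) (forms r d)" for t
  have l: "l t \<in> forms r 1" for t
    unfolding l_def using a b subspace_forms[of r 1]
    by (auto intro: poly_space.subspace_add poly_space.subspace_scale)
  have S_forms: "S t \<subseteq> forms r (Suc d)" for t
    unfolding S_def using V(2) l by (intro adjoin_multiples_subset_forms) auto
  have V_S: "V \<subseteq> S t" for t unfolding S_def using subspace_forms by (rule subset_adjoin_multiples)
  have mult_S: "l t * F \<in> S t" if "F \<in> forms r d" for t F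
    unfolding S_def using V(1) that by (rule multiple_in_adjoin_multiples)
  obtain X :: "'k mpoly set" where X: "finite X" "forms r (Suc d) \<subseteq> poly_space.span X"
    by (rule forms_finitely_spanned)
  let ?G = "V \<union> (*) (l t\<^sub>0) ` forms r d"
  obtain B where B: "B \<subseteq> ?G" "poly_space.independent B" "?G \<subseteq> poly_space.span B"
    by (rule poly_space.maximal_independent_subset)
  have G_S: "?G \<subseteq> S t\<^sub>0" using V_S mult_S by auto
  have B_S: "B \<subseteq> S t\<^sub>0" using B(1) G_S by (rule order_trans)
  have "S t\<^sub>0 \<subseteq> poly_space.span B"
  proof
    fix x assume "x \<in> S t\<^sub>0"
    then obtain v F where "x = v + l t\<^sub>0 * F" "v \<in> V" "F \<in> forms r d"
      unfolding S_def adjoin_multiples_def by blast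
    then show "x \<in> poly_space.span B" using B(3) by (auto intro!: poly_space.span_add)
  qed
  then have card_B: "card B = poly_space.dim (S t\<^sub>0)"
    using B(2) B_S by (intro poly_space.basis_card_eq_dim)
  have "finite B"
    using X B(2) B_S S_forms[of t\<^sub>0] by (intro poly_space.finite_if_independent[of X "S t\<^sub>0" B]) auto
  then obtain e where e: "bij_betw e {..<card B} B" using ex_bij_betw_nat_finite[of B] by (auto simp: atLeast0LessThan)
  have "\<exists>u v. x = u + poly_const t\<^sub>0 * v \<and> (\<forall>t. u + poly_const t * v \<in> S t)" if "x \<in> B" for x
  proof -
    from that B(1) consider "x \<in> V" | F where "F \<in> forms r d" "x = l t\<^sub>0 * F" by blast
    then show ?thesis
    proof cases
      case 1
      then have "x = x + poly_const t\<^sub>0 * 0 \<and> (\<forall>t. x + poly_const t * 0 \<in> S t)" using V_S by auto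
      then show ?thesis by blast
    next
      case 2
      have "a * F + poly_const t * (b * F) = l t * F" for t by (simp add: l_def algebra_simps)
      then have "x = a * F + poly_const t\<^sub>0 * (b * F) \<and> (\<forall>t. a * F + poly_const t * (b * F) \<in> S t)"
        using 2 mult_S by simp
      then show ?thesis by blast
    qed
  qed
  then obtain u v where uv: "\<And>x. x \<in> B \<Longrightarrow> x = u x + poly_const t\<^sub>0 * v x"
    "\<And>x t. x \<in> B \<Longrightarrow> u x + poly_const t * v x \<in> S t" by metis
  define w where "w i m = [:Poly_Mapping.lookup (u (e i)) m, Poly_Mapping.lookup (v (e i)) m:]" for i m
  define g where "g i t = u (e i) + poly_const t * v (e i)" for i t
  have lookup_g: "(\<Sum>i<card B. c i * poly (w i m) t)
      = Poly_Mapping.lookup (\<Sum>i<card B. poly_const (c i) * g i t) m" for c t m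
    by (simp add: w_def g_def lookup_sum lookup_add lookup_poly_const_mult)
  have zero_iff: "(\<forall>m. (\<Sum>i<card B. c i * poly (w i m) t) = 0)
      \<longleftrightarrow> (\<Sum>i<card B. poly_const (c i) * g i t) = 0" for c t
    unfolding lookup_g by (auto intro: poly_mapping_eqI)
  have "finite {t. \<exists>c. (\<forall>m. (\<Sum>i<card B. c i * poly (w i m) t) = 0) \<and> (\<exists>i<card B. c i \<noteq> 0)}"
  proof (rule cofinite_independent)
    fix c assume "\<And>m. (\<Sum>i<card B. c i * poly (w i m) t\<^sub>0) = 0"
    then have "(\<Sum>i<card B. poly_const (c i) * g i t\<^sub>0) = 0" using zero_iff by blast
    moreover have "g i t\<^sub>0 = e i" if "i < card B" for i
    proof -
      have "e i \<in> B" using e that by (auto simp: bij_betw_def)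
      then show ?thesis unfolding g_def by (rule uv(1)[symmetric])
    qed
    ultimately have "(\<Sum>i<card B. poly_const (c i) * e i) = 0" by simp
    also have "(\<Sum>i<card B. poly_const (c i) * e i)
        = (\<Sum>i<card B. poly_const (c (inv_into {..<card B} e (e i))) * e i)"
      using e by (intro sum.cong) (auto simp: bij_betw_def)
    also have "\<dots> = (\<Sum>x\<in>B. poly_const (c (inv_into {..<card B} e x)) * x)"
      by (rule sum.reindex_bij_betw[OF e])
    finally have sum_0: "(\<Sum>x\<in>B. poly_const (c (inv_into {..<card B} e x)) * x) = 0" .
    have zero: "c (inv_into {..<card B} e x) = 0" if "x \<in> B" for x
      using poly_space.independentD[where u = "\<lambda>x. c (inv_into {..<card B} e x)",
          OF B(2) \<open>finite B\<close> subset_refl sum_0 that] .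
    show "\<forall>i<card B. c i = 0"
    proof (intro allI impI)
      fix i assume "i < card B"
      then have "e i \<in> B" "inv_into {..<card B} e (e i) = i" using e by (auto simp: bij_betw_def)
      then show "c i = 0" using zero[of "e i"] by simp
    qed
  qed
  moreover have "card B \<le> poly_space.dim (S t)"
    if "t \<notin> {t. \<exists>c. (\<forall>m. (\<Sum>i<card B. c i * poly (w i m) t) = 0) \<and> (\<exists>i<card B. c i \<noteq> 0)}" for t
  proof (rule poly_space.card_family_le_dim[OF X(1)])
    show "S t \<subseteq> poly_space.span X" using S_forms X(2) by blast
    show "g i t \<in> S t" if "i < card B" for i
    proof -
      have "e i \<in> B" using e that by (auto simp: bij_betw_def)
      then show ?thesis unfolding g_def by (rule uv(2))
    qed
    show "\<forall>i<card B. c i = 0" if "(\<Sum>i<card B. poly_const (c i) * g i t) = 0" for c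
      using that \<open>t \<notin> _\<close> zero_iff by blast
  qed
  then have "{t. poly_space.dim (S t) < poly_space.dim (S t\<^sub>0)}
      \<subseteq> {t. \<exists>c. (\<forall>m. (\<Sum>i<card B. c i * poly (w i m) t) = 0) \<and> (\<exists>i<card B. c i \<noteq> 0)}"
    unfolding card_B[symmetric] not_le[symmetric] by blast
  ultimately have "finite {t. poly_space.dim (S t) < poly_space.dim (S t\<^sub>0)}"
    by (rule rev_finite_subset)
  then show ?thesis unfolding S_def l_def .
qed

text \<open>
  Two conditions of maximal rank, each satisfied by some linear form, are satisfied together:
  on the line joining the two forms each excludes only finitely many points, and the field is
  infinite. Lines thus take the place of the Zariski topology on the space of linear forms.
\<close>

lemma common_generic_linear_form:
  fixes V W :: "'k::field_char_0 mpoly set"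
  assumes V: "poly_space.subspace V" "V \<subseteq> forms r (Suc d)" and W: "poly_space.subspace W" "W \<subseteq> forms r (Suc e)"
    and k: "k \<in> forms r 1" and l: "l \<in> forms r 1"
  obtains h where "h \<in> forms r 1"
    "poly_space.dim (adjoin_multiples V k (forms r d)) \<le> poly_space.dim (adjoin_multiples V h (forms r d))"
    "poly_space.dim (adjoin_multiples W l (forms r e)) \<le> poly_space.dim (adjoin_multiples W h (forms r e))"
proof -
  have lk: "l - k \<in> forms r 1" by (rule poly_space.subspace_diff[OF subspace_forms l k])
  note bad1 = finite_dim_drops_on_line[OF V k lk, of 0]
  note bad2 = finite_dim_drops_on_line[OF W k lk, of 1]
  obtain t where t: "t \<notin> {t. poly_space.dim (adjoin_multiples V (k + poly_const t * (l - k)) (forms r d))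
        < poly_space.dim (adjoin_multiples V (k + poly_const 0 * (l - k)) (forms r d))} \<union>
      {t. poly_space.dim (adjoin_multiples W (k + poly_const t * (l - k)) (forms r e))
        < poly_space.dim (adjoin_multiples W (k + poly_const 1 * (l - k)) (forms r e))}"
    using ex_new_if_finite[OF infinite_UNIV_char_0 finite_UnI[OF bad1 bad2]] by blast
  show ?thesis
  proof (rule that)
    show "k + poly_const t * (l - k) \<in> forms r 1"
      using k lk subspace_forms by (auto intro: poly_space.subspace_add poly_space.subspace_scale)
  qed (use t in \<open>auto simp: not_less\<close>)
qed

lemma subspace_mult_preimage:
  assumes A: "poly_space.subspace A" and V: "poly_space.subspace V"
  shows "poly_space.subspace {F \<in> A. l * F \<in> V}"
proof (rule poly_space.subspaceI)
  show "0 \<in> {F \<in> A. l * F \<in> V}" using A V by (simp add: poly_space.subspace_0)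
next
  fix F G assume "F \<in> {F \<in> A. l * F \<in> V}" "G \<in> {F \<in> A. l * F \<in> V}"
  then show "F + G \<in> {F \<in> A. l * F \<in> V}"
    using A V by (simp add: poly_space.subspace_add distrib_left)
next
  fix c F assume F: "F \<in> {F \<in> A. l * F \<in> V}"
  have "l * (poly_const c * F) \<in> V"
    unfolding mult.left_commute[of l] using F by (intro poly_space.subspace_scale[OF V]) simp
  then show "poly_const c * F \<in> {F \<in> A. l * F \<in> V}"
    using F poly_space.subspace_scale[OF A] by simp
qed

section \<open>Green's bound\<close>

text \<open>
  Green's hyperplane restriction theorem, stated for the rank of multiplication by \<open>l\<close>. Let \<open>\<rho>\<close> be
  the largest rank, attained by \<open>h\<close>. The preimage \<open>W\<close> of \<open>V\<close> under \<open>h\<close> has codimension \<open>\<rho>\<close> in degree one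
  less, and \<open>V + h R\<close> has codimension \<open>c - \<rho>\<close>. A general \<open>l\<close> has rank at least the bound for each of
  them by induction, and these two ranks add up to at most the rank of \<open>l\<close> on \<open>V\<close>, hence to at most \<open>\<rho>\<close>;
  the rest is arithmetic. As \<open>V + h R\<close> stays inside the same space of forms, the induction is on the
  codimension and not on the number of variables.
\<close>

theorem green_rank_bound:
  fixes V :: "'k::field_char_0 mpoly set"
  assumes "poly_space.subspace V" "V \<subseteq> forms r (Suc d)"
  shows "\<exists>l \<in> forms r 1. poly_space.dim V
      + rank_bound (Suc d) (poly_space.dim (forms r (Suc d) :: 'k mpoly set) - poly_space.dim V)
    \<le> poly_space.dim (adjoin_multiples V l (forms r d))"
  using assms
proof (induction d arbitrary: V)
  case 0
  show ?case
  proof (cases "forms r (Suc 0) \<subseteq> V")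
    case True
    then have "V = forms r (Suc 0)" using 0(2) by simp
    moreover have "poly_space.dim V \<le> poly_space.dim (adjoin_multiples V 0 (forms r 0))"
      using 0(2) subspace_forms[of r 0] poly_space.subspace_0[OF subspace_forms[of r 1]]
      by (intro dim_mono_forms[of _ r "Suc 0"] adjoin_multiples_subset_forms subset_adjoin_multiples) auto
    ultimately show ?thesis
      using poly_space.subspace_0[OF subspace_forms[of r 1]] by (intro bexI[of _ 0]) simp_all
  next
    case False
    then obtain l where l: "l \<in> forms r 1" "l \<notin> V" by auto
    let ?S = "adjoin_multiples V l (forms r 0)"
    have S: "?S \<subseteq> forms r (Suc 0)" using 0(2) l(1) by (intro adjoin_multiples_subset_forms) auto
    have "V \<subseteq> ?S" by (rule subset_adjoin_multiples[OF subspace_forms])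
    moreover have "l \<in> ?S"
      using multiple_in_adjoin_multiples[OF 0(1) poly_const_in_forms, of l 1] by simp
    ultimately have "\<not> poly_space.dim ?S \<le> poly_space.dim V"
      using forms_subspace_eqI[OF S 0(1)] l(2) by blast
    moreover have "rank_bound (Suc 0) c \<le> 1" for c
      using rank_bound_1_left[of c] by (cases "c = 0") auto
    note this[of "poly_space.dim (forms r (Suc 0) :: 'k mpoly set) - poly_space.dim V"]
    ultimately show ?thesis using l(1) by (intro bexI[of _ l]) linarith+
  qed
next
  case (Suc d)
  define A where "A = (forms r (Suc d) :: 'k mpoly set)"
  define D where "D = poly_space.dim (forms r (Suc (Suc d)) :: 'k mpoly set)"
  have A: "poly_space.subspace A" unfolding A_def by (rule subspace_forms)
  from Suc.prems show ?case
    unfolding A_def[symmetric] D_def[symmetric]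
  proof (induction "D - poly_space.dim V" arbitrary: V rule: less_induct)
    case less
    let ?gain = "\<lambda>l. poly_space.dim (adjoin_multiples V l A)"
    have forms: "adjoin_multiples V l A \<subseteq> forms r (Suc (Suc d))" if "l \<in> forms r 1" for l
      unfolding A_def using less.prems(2) that by (intro adjoin_multiples_subset_forms) auto
    have V_sub: "V \<subseteq> adjoin_multiples V l A" for l by (rule subset_adjoin_multiples[OF A])
    have "\<exists>h. h \<in> forms r 1 \<and> (\<forall>l. l \<in> forms r 1 \<longrightarrow> ?gain l \<le> ?gain h)"
    proof (rule ex_has_greatest_nat)
      show "0 \<in> forms r 1" by (rule poly_space.subspace_0[OF subspace_forms])
      show "\<forall>l. l \<in> forms r 1 \<longrightarrow> ?gain l < Suc D"
        using dim_mono_forms[OF subset_refl forms] unfolding D_def by (auto simp: less_Suc_eq_le)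
    qed
    then obtain h where h: "h \<in> forms r 1" and max: "\<And>l. l \<in> forms r 1 \<Longrightarrow> ?gain l \<le> ?gain h"
      by blast
    define V' where "V' = adjoin_multiples V h A"
    have V': "poly_space.subspace V'" "V' \<subseteq> forms r (Suc (Suc d))"
      unfolding V'_def using less.prems A h forms by (auto intro: subspace_adjoin_multiples)
    have V_V': "poly_space.dim V \<le> poly_space.dim V'"
      unfolding V'_def by (intro dim_mono_forms[OF forms[OF h] V_sub])
    have V'_D: "poly_space.dim V' \<le> D" unfolding D_def by (rule dim_mono_forms[OF subset_refl V'(2)])
    define c \<rho> where "c = D - poly_space.dim V" and "\<rho> = poly_space.dim V' - poly_space.dim V"
    have "\<rho> \<le> c" and c_rho: "D - poly_space.dim V' = c - \<rho>"
      unfolding c_def \<rho>_def using V_V' V'_D by auto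
    have "rank_bound (Suc (Suc d)) c \<le> \<rho>"
    proof (cases "\<rho> = 0")
      case True
      have "V = adjoin_multiples V l A" if l: "l \<in> forms r 1" for l
        using max[OF l] True V_V' unfolding \<rho>_def V'_def
        by (intro forms_subspace_eqI[OF forms[OF l] less.prems(1) V_sub]) auto
      then have "l * F \<in> V" if "l \<in> forms r 1" "F \<in> A" for l F
        using multiple_in_adjoin_multiples[OF less.prems(1) that(2), of l] that by metis
      then have "forms r (Suc (Suc d)) \<subseteq> V"
        using poly_var_in_forms unfolding A_def by (intro forms_Suc_subset[OF less.prems(1)]) blast
      then have "V = forms r (Suc (Suc d))" using less.prems(2) by blast
      then have "c = 0" unfolding c_def D_def by simp
      then show ?thesis by simp
    next
      case False
      define W where "W = {F \<in> A. h * F \<in> V}"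
      have W: "poly_space.subspace W" "W \<subseteq> forms r (Suc d)"
        unfolding W_def using subspace_mult_preimage[OF A less.prems(1)] by (auto simp: A_def)
      have dim_W: "poly_space.dim V' + poly_space.dim W = poly_space.dim V + poly_space.dim A"
        unfolding V'_def W_def A_def by (rule dim_adjoin_multiples[OF less.prems])
      then have codim_W: "poly_space.dim A - poly_space.dim W = \<rho>" unfolding \<rho>_def using V_V' by linarith
      have "D - poly_space.dim V' < D - poly_space.dim V"
        using False c_rho \<open>\<rho> \<le> c\<close> unfolding c_def by linarith
      \<comment> \<open>The two induction hypotheses: smaller codimension, and smaller degree.\<close>
      from less.hyps[OF this V'] obtain l2 where l2: "l2 \<in> forms r 1"
        "poly_space.dim V' + rank_bound (Suc (Suc d)) (c - \<rho>) \<le> poly_space.dim (adjoin_multiples V' l2 A)"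
        unfolding c_rho by blast
      from Suc.IH[OF W] obtain l1 where l1: "l1 \<in> forms r 1"
        "poly_space.dim W + rank_bound (Suc d) \<rho> \<le> poly_space.dim (adjoin_multiples W l1 (forms r d))"
        unfolding A_def[symmetric] codim_W by blast
      from common_generic_linear_form[OF W V' l1(1) l2(1)] obtain l where l: "l \<in> forms r 1"
        "poly_space.dim (adjoin_multiples W l1 (forms r d)) \<le> poly_space.dim (adjoin_multiples W l (forms r d))"
        "poly_space.dim (adjoin_multiples V' l2 A) \<le> poly_space.dim (adjoin_multiples V' l A)"
        unfolding A_def by blast
      define X where "X = adjoin_multiples V l A"
      have X: "poly_space.subspace X" "X \<subseteq> forms r (Suc (Suc d))"
        unfolding X_def using less.prems A l(1) forms by (auto intro: subspace_adjoin_multiples)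
      \<comment> \<open>The two gains are measured inside \<open>X\<close>: one modulo the multiples of \<open>h\<close>, one within them.\<close>
      have "adjoin_multiples V' l A \<subseteq> adjoin_multiples X h A"
      proof
        fix x assume "x \<in> adjoin_multiples V' l A"
        then obtain v F G where x: "x = (v + h * F) + l * G" "v \<in> V" "F \<in> A" "G \<in> A"
          unfolding V'_def adjoin_multiples_def by blast
        have "v + l * G \<in> X" using x unfolding X_def adjoin_multiples_def by blast
        moreover have "x = (v + l * G) + h * F" using x(1) by (simp add: algebra_simps)
        ultimately show "x \<in> adjoin_multiples X h A"
          using x(3) unfolding adjoin_multiples_def[of X] by blast
      qed
      moreover have "adjoin_multiples X h A \<subseteq> forms r (Suc (Suc d))"
        unfolding A_def using X(2) h by (intro adjoin_multiples_subset_forms) auto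
      ultimately have "poly_space.dim (adjoin_multiples V' l A) \<le> poly_space.dim (adjoin_multiples X h A)"
        by (intro dim_mono_forms)
      moreover have "poly_space.dim (adjoin_multiples W l (forms r d)) \<le> poly_space.dim {F \<in> A. h * F \<in> X}"
      proof (rule dim_mono_forms[of _ r "Suc d"])
        show "adjoin_multiples W l (forms r d) \<subseteq> {F \<in> A. h * F \<in> X}"
        proof
          fix F assume F: "F \<in> adjoin_multiples W l (forms r d)"
          then obtain w G where wG: "F = w + l * G" "w \<in> W" "G \<in> forms r d"
            unfolding adjoin_multiples_def by blast
          have "h * F = h * w + l * (h * G)" using wG(1) by (simp add: algebra_simps)
          moreover have "h * w \<in> V" using wG(2) by (simp add: W_def)
          moreover have "h * G \<in> A" unfolding A_def using h wG(3) by (rule forms_mult_linear)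
          ultimately have "h * F \<in> X" unfolding X_def adjoin_multiples_def by blast
          moreover have "F \<in> A"
            using F adjoin_multiples_subset_forms[OF W(2) l(1) subset_refl] unfolding A_def by blast
          ultimately show "F \<in> {F \<in> A. h * F \<in> X}" by simp
        qed
      qed (auto simp: A_def)
      moreover have "poly_space.dim (adjoin_multiples X h A) + poly_space.dim {F \<in> A. h * F \<in> X}
          = poly_space.dim X + poly_space.dim A"
        unfolding A_def by (rule dim_adjoin_multiples[OF X])
      moreover have "poly_space.dim X \<le> poly_space.dim V'"
        unfolding X_def V'_def by (rule max[OF l(1)])
      ultimately have "rank_bound (Suc (Suc d)) (c - \<rho>) + rank_bound (Suc d) \<rho> \<le> \<rho>"
        using l1(2) l2(2) l(2,3) dim_W V_V' unfolding \<rho>_def by linarith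
      then show ?thesis using \<open>\<rho> \<le> c\<close> by (rule rank_bound_le_of_split)
    qed
    then have "poly_space.dim V + rank_bound (Suc (Suc d)) c \<le> ?gain h"
      using V_V' unfolding \<rho>_def V'_def by linarith
    then show ?case using h unfolding c_def by blast
  qed
qed

section \<open>The socle in terms of the h-vector\<close>

definition hilbert_fun :: "nat \<Rightarrow> 'k::field mpoly set \<Rightarrow> nat \<Rightarrow> nat" where
  "hilbert_fun r I i = poly_space.dim (forms r i :: 'k mpoly set) - poly_space.dim (I \<inter> forms r i)"

text \<open>
  The preimage in $R_i$ of the degree \<open>i\<close> part of the socle.
\<close>

definition socle_forms :: "nat \<Rightarrow> 'k::field mpoly set \<Rightarrow> nat \<Rightarrow> 'k mpoly set" where
  "socle_forms r I i = {F \<in> forms r i. \<forall>j<r. poly_var j * F \<in> I}"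

lemma forms_subset_carrier: "forms r d \<subseteq> carrier (poly_ring r)"
  by (auto simp: forms_def)

lemma ideal_poly_ringD:
  assumes "ideal I (poly_ring r)"
  shows "0 \<in> I" "p \<in> I \<Longrightarrow> q \<in> I \<Longrightarrow> p + q \<in> I"
    and "p \<in> carrier (poly_ring r) \<Longrightarrow> q \<in> I \<Longrightarrow> p * q \<in> I"
proof -
  interpret ideal I "poly_ring r" by (rule assms)
  show "0 \<in> I"
    using additive_subgroup.zero_closed[OF is_additive_subgroup] by (simp add: poly_ring_def)
  show "p \<in> I \<Longrightarrow> q \<in> I \<Longrightarrow> p + q \<in> I" 
    using additive_subgroup.a_closed[OF is_additive_subgroup, of p q] by (simp add: poly_ring_def)
  show "p \<in> carrier (poly_ring r) \<Longrightarrow> q \<in> I \<Longrightarrow> p * q \<in> I"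
    using I_l_closed[of q p] by (simp add: poly_ring_def)
qed

lemma form_times_ideal:
  assumes "ideal I (poly_ring r)" "p \<in> forms r d" "q \<in> I" shows "p * q \<in> I"
  using ideal_poly_ringD(3)[OF assms(1) _ assms(3)] assms(2) forms_subset_carrier by blast

lemma subspace_ideal: assumes "ideal I (poly_ring r)" shows "poly_space.subspace I"
  using ideal_poly_ringD[OF assms] form_times_ideal[OF assms poly_const_in_forms]
  by (auto simp: poly_space.subspace_def)

lemma subspace_ideal_forms: "ideal I (poly_ring r) \<Longrightarrow> poly_space.subspace (I \<inter> forms r i)"
  by (intro poly_space.subspace_inter subspace_ideal subspace_forms)

lemma subspace_socle_forms:
  assumes I: "ideal I (poly_ring r)" shows "poly_space.subspace (socle_forms r I i)"
proof -
  have "socle_forms r I i = forms r i \<inter> (\<Inter>j\<in>{..<r}. {F \<in> UNIV. poly_var j * F \<in> I})"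
    by (auto simp: socle_forms_def)
  moreover have "poly_space.subspace (\<Inter>j\<in>{..<r}. {F \<in> UNIV. poly_var j * F \<in> I})"
    using subspace_mult_preimage[OF poly_space.subspace_UNIV subspace_ideal[OF I]]
    by (intro poly_space.subspace_Inter) blast
  ultimately show ?thesis by (simp add: poly_space.subspace_inter subspace_forms)
qed

lemma socle_forms_mult_linear:
  assumes I: "ideal I (poly_ring r)" and F: "F \<in> socle_forms r I i" and l: "l \<in> forms r 1"
  shows "l * F \<in> I"
proof -
  have "forms r (Suc 0) \<subseteq> {p. p * F \<in> I}"
  proof (rule forms_Suc_subset)
    show "poly_space.subspace {p. p * F \<in> I}"
      using subspace_ideal[OF I] by (auto simp: poly_space.subspace_def distrib_right mult.assoc)
    fix j and c :: "'a mpoly" assume "j < r" and c: "c \<in> forms r 0"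
    then have "c * (poly_var j * F) \<in> I"
      using F by (intro form_times_ideal[OF I c]) (auto simp: socle_forms_def)
    then show "poly_var j * c \<in> {p. p * F \<in> I}" by (simp add: ac_simps)
  qed
  then show ?thesis using l by auto
qed

lemma ideal_forms_subset_socle_forms:
  assumes "ideal I (poly_ring r)" shows "I \<inter> forms r i \<subseteq> socle_forms r I i"
  using form_times_ideal[OF assms poly_var_in_forms] by (auto simp: socle_forms_def)

lemma preimage_in_degree:
  assumes "l \<in> forms r 1"
  shows "{F \<in> forms r i. l * F \<in> I \<inter> forms r (Suc i)} = {F \<in> forms r i. l * F \<in> I}"
  using forms_mult_linear[OF assms] by auto

text \<open>
  A socle form is killed by every linear form, in particular by one whose rank from degree \<open>i\<close> to
  degree \<open>i + 1\<close> meets Green's bound, and that rank is at most the codimension of the socle forms.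
\<close>

lemma rank_bound_le_codim_socle_forms:
  fixes I :: "'k::field_char_0 mpoly set"
  assumes I: "ideal I (poly_ring r)"
  shows "poly_space.dim (socle_forms r I i) + rank_bound (Suc i) (hilbert_fun r I (Suc i))
    \<le> poly_space.dim (forms r i :: 'k mpoly set)"
proof -
  let ?J = "I \<inter> forms r (Suc i)"
  have J: "poly_space.subspace ?J" "?J \<subseteq> forms r (Suc i)" using subspace_ideal_forms[OF I] by auto
  from green_rank_bound[OF J] obtain l where l: "l \<in> forms r 1"
    and rank: "poly_space.dim ?J + rank_bound (Suc i) (hilbert_fun r I (Suc i))
      \<le> poly_space.dim (adjoin_multiples ?J l (forms r i))"
    unfolding hilbert_fun_def by blast
  have "poly_space.dim (socle_forms r I i) \<le> poly_space.dim {F \<in> forms r i. l * F \<in> ?J}"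
    unfolding preimage_in_degree[OF l] using socle_forms_mult_linear[OF I _ l]
    by (intro dim_mono_forms[of _ r i]) (auto simp: socle_forms_def)
  then show ?thesis using rank dim_adjoin_multiples[OF J, of l i] by linarith
qed

text \<open>
  Let \<open>d = i + 1\<close>. When the growth from degree \<open>d\<close> to \<open>d + 1\<close> is maximal, Green's bound there equals
  \<open>h\<^sub>d\<close>, so some linear form \<open>l\<close> is injective on $A_d$. A form of degree \<open>i\<close> killed by \<open>l\<close> is then a socle
  form, as \<open>l (x F) = x (l F) = 0\<close> forces \<open>x F = 0\<close> for every variable \<open>x\<close>. It remains to bound the rank
  of \<open>l\<close> from $A_i$ to $A_d$ from above, that is, the dimension of \<open>A / l A\<close> in degree \<open>d\<close> from below. In degree
  \<open>d + 1\<close> this dimension is the growth excess, and Green's bound for \<open>A / l A\<close> carries it down to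
  degree \<open>d\<close>.
\<close>

lemma codim_socle_forms_le_rank_bound:
  fixes I :: "'k::field_char_0 mpoly set"
  assumes I: "ideal I (poly_ring r)"
    and growth: "hilbert_fun r I (Suc (Suc i))
      = hilbert_fun r I (Suc i) + growth_excess (Suc i) (hilbert_fun r I (Suc i))"
  shows "poly_space.dim (forms r i :: 'k mpoly set)
    \<le> poly_space.dim (socle_forms r I i) + rank_bound (Suc i) (hilbert_fun r I (Suc i))"
proof -
  let ?R = "\<lambda>d. forms r d :: 'k mpoly set"
  let ?J = "\<lambda>d. I \<inter> ?R d"
  define d where "d = Suc i"
  define h where "h = hilbert_fun r I d"
  have J: "poly_space.subspace (?J d)" "?J d \<subseteq> ?R d" for d using subspace_ideal_forms[OF I] by auto
  have J_le: "poly_space.dim (?J d) \<le> poly_space.dim (?R d)" for d by (rule dim_mono_forms) auto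
  have "rank_bound (Suc d) (hilbert_fun r I (Suc d)) = h"
    using growth rank_bound_growth[of d h] unfolding h_def d_def by simp
  moreover have "\<exists>l\<in>forms r 1. poly_space.dim (?J (Suc d)) + rank_bound (Suc d) (hilbert_fun r I (Suc d))
      \<le> poly_space.dim (adjoin_multiples (?J (Suc d)) l (?R d))"
    unfolding hilbert_fun_def by (rule green_rank_bound[OF J])
  ultimately obtain l where l: "l \<in> forms r 1"
    and rank: "poly_space.dim (?J (Suc d)) + h
      \<le> poly_space.dim (adjoin_multiples (?J (Suc d)) l (?R d))"
    by auto
  define K where "K = {F \<in> ?R d. l * F \<in> I}"
  define S where "S = adjoin_multiples (?J (Suc d)) l (?R d)"
  have dim_S: "poly_space.dim S + poly_space.dim K = poly_space.dim (?J (Suc d)) + poly_space.dim (?R d)"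
    using dim_adjoin_multiples[OF J, of "Suc d" l d] unfolding preimage_in_degree[OF l] S_def K_def .
  have J_K: "?J d \<subseteq> K" unfolding K_def using form_times_ideal[OF I l] by auto
  have K: "K \<subseteq> ?R d" unfolding K_def by auto
  \<comment> \<open>\<open>K\<close> is the kernel of \<open>l\<close> on $A_d$, seen in $R_d$.\<close>
  have h_dim: "poly_space.dim (?J d) + h = poly_space.dim (?R d)"
    using J_le[of d] unfolding h_def hilbert_fun_def by simp
  have "poly_space.dim K \<le> poly_space.dim (?J d)"
    using rank dim_S h_dim unfolding S_def[symmetric] by linarith
  then have K_eq: "?J d = K" by (intro forms_subspace_eqI[OF K J(1) J_K])
  have S: "poly_space.subspace S" "S \<subseteq> ?R (Suc d)"
    unfolding S_def
    by (rule subspace_adjoin_multiples[OF J(1) subspace_forms])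
      (rule adjoin_multiples_subset_forms[OF J(2) l subset_refl])
  have "poly_space.dim S = poly_space.dim (?J (Suc d)) + h"
    using dim_S h_dim unfolding K_eq[symmetric] by linarith
  moreover have "poly_space.dim (?R (Suc d)) - poly_space.dim (?J (Suc d)) = h + growth_excess d h"
    using growth unfolding h_def d_def hilbert_fun_def[of r I "Suc (Suc i)"] .
  ultimately have "poly_space.dim (?R (Suc d)) - poly_space.dim S = growth_excess d h"
    by linarith
  from green_rank_bound[OF S, unfolded this rank_bound_growth_excess] obtain l' where l': "l' \<in> forms r 1"
    and rank': "poly_space.dim S + restrict_bound d h \<le> poly_space.dim (adjoin_multiples S l' (?R d))"
    by blast
  \<comment> \<open>\<open>?Q\<close> is the degree \<open>d\<close> part of the ideal that defines \<open>A / l A\<close>, and \<open>S\<close> is its part of degree \<open>d + 1\<close>.\<close>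
  let ?Q = "adjoin_multiples (?J d) l (?R i)"
  have Q: "?Q \<subseteq> ?R d" unfolding d_def using l by (intro adjoin_multiples_subset_forms) auto
  have "?Q \<subseteq> {F \<in> ?R d. l' * F \<in> S}"
  proof
    fix F assume F: "F \<in> ?Q"
    then obtain p G where pG: "F = p + l * G" "p \<in> ?J d" "G \<in> ?R i"
      unfolding adjoin_multiples_def by blast
    have "l' * p \<in> ?J (Suc d)"
      using pG(2) form_times_ideal[OF I l'] forms_mult_linear[OF l'] by blast
    moreover have "l' * G \<in> ?R d" unfolding d_def by (rule forms_mult_linear[OF l' pG(3)])
    moreover have "l' * F = l' * p + l * (l' * G)" using pG(1) by (simp add: algebra_simps)
    ultimately have "l' * F \<in> S" unfolding S_def adjoin_multiples_def by blast
    then show "F \<in> {F \<in> ?R d. l' * F \<in> S}" using F Q by blast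
  qed
  then have "poly_space.dim ?Q \<le> poly_space.dim {F \<in> ?R d. l' * F \<in> S}"
    by (intro dim_mono_forms[of _ r d]) auto
  then have "poly_space.dim ?Q + restrict_bound d h \<le> poly_space.dim (?R d)"
    using rank' dim_adjoin_multiples[OF S, of l' d] by linarith
  moreover have "poly_space.dim ?Q + poly_space.dim {F \<in> ?R i. l * F \<in> I}
      = poly_space.dim (?J d) + poly_space.dim (?R i)"
    using dim_adjoin_multiples[OF J, of d l i] preimage_in_degree[OF l, of i I] unfolding d_def by simp
  moreover have "{F \<in> ?R i. l * F \<in> I} \<subseteq> socle_forms r I i"
  proof
    fix F assume F: "F \<in> {F \<in> ?R i. l * F \<in> I}"
    have "poly_var j * F \<in> I" if j: "j < r" for j
    proof -
      have "poly_var j * (l * F) \<in> I" using F form_times_ideal[OF I poly_var_in_forms[OF j]] by blast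
      then have "l * (poly_var j * F) \<in> I" by (simp add: ac_simps)
      moreover have "poly_var j * F \<in> ?R d"
        unfolding d_def using F by (intro forms_mult_linear[OF poly_var_in_forms[OF j]]) auto
      ultimately have "poly_var j * F \<in> K" unfolding K_def by blast
      then show ?thesis unfolding K_eq[symmetric] by blast
    qed
    then show "F \<in> socle_forms r I i" using F by (simp add: socle_forms_def)
  qed
  then have "poly_space.dim {F \<in> ?R i. l * F \<in> I} \<le> poly_space.dim (socle_forms r I i)"
    by (intro dim_mono_forms[of _ r i]) (auto simp: socle_forms_def)
  moreover have "rank_bound d h + restrict_bound d h = h" by (rule rank_plus_restrict)
  ultimately have "poly_space.dim (?R i) \<le> poly_space.dim (socle_forms r I i) + rank_bound d h"
    using h_dim by linarith
  then show ?thesis unfolding h_def d_def .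
qed

section \<open>Dimensions in the quotient algebra\<close>

lemma cring_poly_ring: "cring (poly_ring r :: 'k::field mpoly ring)"
proof (rule cringI)
  have uminus: "- p \<in> carrier (poly_ring r)" if "p \<in> carrier (poly_ring r)" for p :: "'k mpoly"
    using that by (auto simp: poly_ring_def in_keys_iff)
  have add: "p + q \<in> carrier (poly_ring r)"
    if "p \<in> carrier (poly_ring r)" "q \<in> carrier (poly_ring r)" for p q :: "'k mpoly"
    using that Poly_Mapping.keys_add[of p q] unfolding poly_ring_def by auto
  have mult: "p * q \<in> carrier (poly_ring r)"
    if "p \<in> carrier (poly_ring r)" "q \<in> carrier (poly_ring r)" for p q :: "'k mpoly"
  proof -
    have "Poly_Mapping.keys m \<subseteq> {..<r}" if m: "m \<in> Poly_Mapping.keys (p * q)" for m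
    proof -
      obtain m1 m2 where "m = m1 + m2" "m1 \<in> Poly_Mapping.keys p" "m2 \<in> Poly_Mapping.keys q"
        using m keys_mult[of p q] by auto
      then show ?thesis
        using \<open>p \<in> _\<close> \<open>q \<in> _\<close> Poly_Mapping.keys_add[of m1 m2] unfolding poly_ring_def by simp blast
    qed
    then show ?thesis by (simp add: poly_ring_def)
  qed
  show "abelian_group (poly_ring r :: 'k mpoly ring)"
  proof (rule abelian_groupI)
    fix p :: "'k mpoly" assume "p \<in> carrier (poly_ring r)"
    from uminus[OF this] show "\<exists>q\<in>carrier (poly_ring r). q \<oplus>\<^bsub>poly_ring r\<^esub> p = \<zero>\<^bsub>poly_ring r\<^esub>"
      by (intro bexI[of _ "- p"]) (simp_all add: poly_ring_def)
  next
    show "p \<oplus>\<^bsub>poly_ring r\<^esub> q \<in> carrier (poly_ring r)"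
      if "p \<in> carrier (poly_ring r)" "q \<in> carrier (poly_ring r)" for p q :: "'k mpoly"
      using add[OF that] by (simp add: poly_ring_def)
  qed (simp_all add: poly_ring_def add.assoc add.commute)
  show "comm_monoid (poly_ring r :: 'k mpoly ring)"
  proof (rule comm_monoidI)
    show "p \<otimes>\<^bsub>poly_ring r\<^esub> q \<in> carrier (poly_ring r)"
      if "p \<in> carrier (poly_ring r)" "q \<in> carrier (poly_ring r)" for p q :: "'k mpoly"
      using mult[OF that] by (simp add: poly_ring_def)
  qed (simp_all add: poly_ring_def mult.assoc mult.commute)
qed (simp add: poly_ring_def distrib_right)

lemma poly_ring_minus:
  fixes p q :: "'k::field mpoly"
  assumes "p \<in> carrier (poly_ring r)" "q \<in> carrier (poly_ring r)"
  shows "p \<ominus>\<^bsub>poly_ring r\<^esub> q = p - q"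
proof -
  interpret cring "poly_ring r :: 'k mpoly ring" by (rule cring_poly_ring)
  have "- q \<in> carrier (poly_ring r)" using assms(2) by (auto simp: poly_ring_def in_keys_iff)
  then have "\<ominus>\<^bsub>poly_ring r\<^esub> q = - q"
    using assms(2) by (intro minus_equality) (simp_all add: poly_ring_def)
  then show ?thesis by (simp add: a_minus_def) (simp add: poly_ring_def)
qed

lemma quot_class_eq_iff:
  fixes p q :: "'k::field mpoly"
  assumes I: "ideal I (poly_ring r)"
    and "p \<in> carrier (poly_ring r)" "q \<in> carrier (poly_ring r)"
  shows "quot_class r I p = quot_class r I q \<longleftrightarrow> p - q \<in> I"
  using ring.quotient_eq_iff_same_a_r_cos[OF cring.axioms(1)[OF cring_poly_ring] assms]
    poly_ring_minus[OF assms(2,3)] by simp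

lemma zero_in_carrier_poly_ring: "0 \<in> carrier (poly_ring r)"
  by (simp add: poly_ring_def)

lemma quot_class_closed:
  assumes "ideal I (poly_ring r)" "p \<in> carrier (poly_ring r)"
  shows "quot_class r I p \<in> carrier (quot_alg r I)"
  by (rule ring_hom_closed[OF ideal.rcos_ring_hom[OF assms(1)] assms(2)])

lemma quot_class_hom:
  fixes p q :: "'k::field mpoly"
  assumes I: "ideal I (poly_ring r)"
    and "p \<in> carrier (poly_ring r)" "q \<in> carrier (poly_ring r)"
  shows "quot_class r I p \<oplus>\<^bsub>quot_alg r I\<^esub> quot_class r I q = quot_class r I (p + q)"
    and "quot_class r I p \<otimes>\<^bsub>quot_alg r I\<^esub> quot_class r I q = quot_class r I (p * q)"
proof -
  note hom = ideal.rcos_ring_hom[OF I]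
  show "quot_class r I p \<oplus>\<^bsub>quot_alg r I\<^esub> quot_class r I q = quot_class r I (p + q)"
    using ring_hom_add[OF hom assms(2,3)] by (simp add: poly_ring_def)
  show "quot_class r I p \<otimes>\<^bsub>quot_alg r I\<^esub> quot_class r I q = quot_class r I (p * q)"
    using ring_hom_mult[OF hom assms(2,3)] by (simp add: poly_ring_def)
qed

lemma quot_class_0:
  assumes "ideal I (poly_ring r)" shows "quot_class r I 0 = \<zero>\<^bsub>quot_alg r I\<^esub>"
  using ring.a_rcos_zero[OF cring.axioms(1)[OF cring_poly_ring] assms ideal_poly_ringD(1)[OF assms]]
  by (simp add: FactRing_def)

lemma quot_class_eq_0_iff:
  assumes "ideal I (poly_ring r)" "p \<in> carrier (poly_ring r)"
  shows "quot_class r I p = \<zero>\<^bsub>quot_alg r I\<^esub> \<longleftrightarrow> p \<in> I"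
  using quot_class_eq_iff[OF assms zero_in_carrier_poly_ring] quot_class_0[OF assms(1)] by simp

lemma poly_const_eq_0_iff: "poly_const c = 0 \<longleftrightarrow> c = 0"
  unfolding poly_const_def by (metis lookup_single_eq lookup_zero single_zero)

lemma poly_const_in_carrier: "poly_const c \<in> carrier (poly_ring r)"
  using poly_const_in_forms forms_subset_carrier by blast

lemma subfield_constants: "subfield (range poly_const) (poly_ring r :: 'k::field mpoly ring)"
proof -
  interpret cring "poly_ring r :: 'k mpoly ring" by (rule cring_poly_ring)
  show ?thesis
  proof (rule subfieldI)
    show "subcring (range poly_const) (poly_ring r :: 'k mpoly ring)"
    proof (rule subcringI', rule subringI)
      show "range poly_const \<subseteq> carrier (poly_ring r :: 'k mpoly ring)" using poly_const_in_carrier by auto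
      show "\<one>\<^bsub>poly_ring r\<^esub> \<in> range (poly_const :: 'k \<Rightarrow> _)"
        by (auto simp: poly_ring_def intro!: image_eqI[of _ _ 1])
      fix p q :: "'k mpoly" assume p: "p \<in> range poly_const" and q: "q \<in> range poly_const"
      from p obtain a where a: "p = poly_const a" by auto
      from q obtain b where b: "q = poly_const b" by auto
      have "\<ominus>\<^bsub>poly_ring r\<^esub> p = poly_const (- a)"
        using poly_const_in_carrier[of "- a" r] poly_const_in_carrier[of a r] unfolding a
        by (intro minus_equality) (simp_all add: poly_ring_def flip: poly_const_add)
      then show "\<ominus>\<^bsub>poly_ring r\<^esub> p \<in> range poly_const" by simp
      show "p \<otimes>\<^bsub>poly_ring r\<^esub> q \<in> range poly_const"
        unfolding a b by (simp add: poly_ring_def flip: poly_const_mult)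
      show "p \<oplus>\<^bsub>poly_ring r\<^esub> q \<in> range poly_const"
        unfolding a b by (simp add: poly_ring_def flip: poly_const_add)
    qed
    show "Units (poly_ring r \<lparr>carrier := range poly_const\<rparr>)
        = range (poly_const :: 'k \<Rightarrow> _) - {\<zero>\<^bsub>poly_ring r\<^esub>}" (is "?U = ?K")
    proof
      show "?U \<subseteq> ?K" by (auto simp: Units_def poly_ring_def)
      show "?K \<subseteq> ?U"
      proof
        fix p assume "p \<in> ?K"
        then obtain a where a: "p = poly_const a" "a \<noteq> 0"
          by (auto simp: poly_ring_def poly_const_eq_0_iff)
        then have "poly_const (inverse a) * p = 1" "p * poly_const (inverse a) = 1"
          by (simp_all flip: poly_const_mult)
        then show "p \<in> ?U" using a(1) by (auto simp: Units_def poly_ring_def)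
      qed
    qed
  qed
qed

lemma subfield_base:
  fixes I :: "'k::field mpoly set"
  assumes I: "ideal I (poly_ring r)" and "1 \<notin> I"
  shows "subfield (quot_class r I ` range poly_const) (quot_alg r I)"
proof (rule ring_hom_ring.img_is_subfield(2)[OF ideal.rcos_ring_hom_ring[OF I] subfield_constants])
  have "quot_class r I 1 = \<one>\<^bsub>quot_alg r I\<^esub>"
    using ring_hom_one[OF ideal.rcos_ring_hom[OF I]] by (simp add: poly_ring_def)
  then show "\<one>\<^bsub>quot_alg r I\<^esub> \<noteq> \<zero>\<^bsub>quot_alg r I\<^esub>"
    using quot_class_eq_0_iff[OF I poly_const_in_carrier, of 1] assms(2) by simp
qed

text \<open>
  Adjoining to \<open>W\<close> one vector outside it extends its image in the quotient by a line, because \<open>W\<close>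
  contains all elements of \<open>I\<close> of its degree. Along a basis of \<open>W\<close> modulo \<open>I\<close> the images
  therefore build up a flag that counts the dimension.
\<close>

lemma dim_over_base_image:
  fixes I :: "'k::field mpoly set"
  assumes I: "ideal I (poly_ring r)" and "1 \<notin> I"
    and W: "poly_space.subspace W" "W \<subseteq> forms r d" "I \<inter> forms r d \<subseteq> W"
  shows "dim_over_base r I (quot_class r I ` W)
    = poly_space.dim W - poly_space.dim (I \<inter> forms r d)"
proof -
  let ?cl = "quot_class r I" and ?J = "I \<inter> forms r d"
  let ?K = "?cl ` range poly_const"
  interpret Q: ring "quot_alg r I" by (rule ideal.quotient_is_ring[OF I])
  have carr: "p \<in> carrier (poly_ring r)" if "p \<in> forms r d" for p :: "'k mpoly"
    using that forms_subset_carrier by blast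
  have J: "poly_space.subspace ?J" by (rule subspace_ideal_forms[OF I])
  obtain BJ where BJ: "BJ \<subseteq> ?J" "poly_space.independent BJ" "?J \<subseteq> poly_space.span BJ"
    "card BJ = poly_space.dim ?J" by (rule poly_space.basis_exists)
  have span_BJ: "poly_space.span BJ = ?J" using BJ poly_space.span_minimal[OF BJ(1) J] by blast
  have "BJ \<subseteq> W" using BJ(1) W(3) by blast
  then obtain B where B: "BJ \<subseteq> B" "B \<subseteq> W" "poly_space.independent B" "W \<subseteq> poly_space.span B"
    using poly_space.maximal_independent_subset_extend[OF _ BJ(2)] by blast
  have span_B: "poly_space.span B = W" using B poly_space.span_minimal[OF B(2) W(1)] by blast
  obtain X :: "'k mpoly set" where X: "finite X" "forms r d \<subseteq> poly_space.span X"
    by (rule forms_finitely_spanned)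
  have fin: "finite B"
    using X(2) W(2) by (intro poly_space.finite_if_independent[OF X(1) _ B(3,2)]) blast
  have "Q.dimension (card C) ?K (?cl ` poly_space.span (BJ \<union> C))"
    if "finite C" "C \<subseteq> B - BJ" for C
    using that
  proof (induction C)
    case empty
    have "?cl p = \<zero>\<^bsub>quot_alg r I\<^esub>" if "p \<in> ?J" for p
      using that quot_class_eq_0_iff[OF I carr] by blast
    moreover have "?J \<noteq> {}" using poly_space.subspace_0[OF J] by blast
    ultimately have "?cl ` ?J = {\<zero>\<^bsub>quot_alg r I\<^esub>}" by auto
    then show ?case using span_BJ Q.zero_dim by simp
  next
    case (insert c C)
    let ?S = "poly_space.span (BJ \<union> C)"
    have "BJ \<union> C \<subseteq> B" using insert.prems B(1) by blast
    then have S_forms: "?S \<subseteq> forms r d"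
      using poly_space.span_mono[of "BJ \<union> C" B] span_B W(2) by blast
    have c: "c \<in> forms r d" using insert.prems B(2) W(2) by blast
    have c_new: "c \<notin> ?S"
    proof
      assume "c \<in> ?S"
      moreover have "BJ \<union> C \<subseteq> B - {c}" using insert.prems insert.hyps B(1) by blast
      ultimately have "c \<in> poly_space.span (B - {c})" using poly_space.span_mono by blast
      then show False using B(3) insert.prems unfolding poly_space.dependent_def by blast
    qed
    have cl_new: "?cl c \<notin> ?cl ` ?S"
    proof
      assume "?cl c \<in> ?cl ` ?S"
      then obtain w where w: "w \<in> ?S" "?cl c = ?cl w" by blast
      have "c - w \<in> I" using w quot_class_eq_iff[OF I carr carr] c S_forms by blast
      moreover have "c - w \<in> forms r d"
        using c w(1) S_forms poly_space.subspace_diff[OF subspace_forms] by blast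
      ultimately have "c - w \<in> poly_space.span BJ" using span_BJ by blast
      then have "c - w \<in> ?S" using poly_space.span_mono[of BJ "BJ \<union> C"] by blast
      then have "(c - w) + w \<in> ?S" using w(1) by (rule poly_space.span_add)
      then show False using c_new by simp
    qed
    have ext: "?cl (poly_const a) \<otimes>\<^bsub>quot_alg r I\<^esub> ?cl c \<oplus>\<^bsub>quot_alg r I\<^esub> ?cl w = ?cl (poly_const a * c + w)"
      if "w \<in> ?S" for a w
    proof -
      have "poly_const a * c \<in> forms r d" using c poly_space.subspace_scale[OF subspace_forms] by blast
      then show ?thesis
        using that S_forms quot_class_hom(2)[OF I poly_const_in_carrier carr[OF c]]
          quot_class_hom(1)[OF I carr carr] by auto
    qed
    have "Q.line_extension ?K (?cl c) (?cl ` ?S) = ?cl ` poly_space.span (BJ \<union> insert c C)"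
    proof
      show "Q.line_extension ?K (?cl c) (?cl ` ?S) \<subseteq> ?cl ` poly_space.span (BJ \<union> insert c C)"
      proof
        fix u assume "u \<in> Q.line_extension ?K (?cl c) (?cl ` ?S)"
        then obtain a w where u: "w \<in> ?S" "u = ?cl (poly_const a * c + w)"
          unfolding Q.line_extension_mem_iff using ext by auto
        have "poly_const a * c + w \<in> poly_space.span (insert c (BJ \<union> C))"
          using u(1) unfolding poly_space.span_insert by (auto intro!: exI[of _ a])
        then show "u \<in> ?cl ` poly_space.span (BJ \<union> insert c C)" using u(2) by simp
      qed
      show "?cl ` poly_space.span (BJ \<union> insert c C) \<subseteq> Q.line_extension ?K (?cl c) (?cl ` ?S)"
      proof
        fix u assume "u \<in> ?cl ` poly_space.span (BJ \<union> insert c C)"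
        then obtain p a where p: "u = ?cl p" "p - poly_const a * c \<in> ?S"
          using poly_space.span_insert[of c "BJ \<union> C"] by auto
        have "u = ?cl (poly_const a) \<otimes>\<^bsub>quot_alg r I\<^esub> ?cl c \<oplus>\<^bsub>quot_alg r I\<^esub> ?cl (p - poly_const a * c)"
          using ext[OF p(2)] p(1) by simp
        then show "u \<in> Q.line_extension ?K (?cl c) (?cl ` ?S)"
          unfolding Q.line_extension_mem_iff using p(2) by blast
      qed
    qed
    moreover have "Q.dimension (Suc (card C)) ?K (Q.line_extension ?K (?cl c) (?cl ` ?S))"
      using insert.IH insert.prems
      by (intro Q.Suc_dim cl_new quot_class_closed[OF I carr[OF c]]) auto
    ultimately show ?case using insert.hyps by simp
  qed
  from this[of "B - BJ"] have "Q.dimension (card (B - BJ)) ?K (?cl ` W)"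
    using fin B(1) span_B by (simp add: Un_absorb1)
  then have "dim_over_base r I (?cl ` W) = card (B - BJ)"
    using Q.dimI[OF subfield_base[OF I assms(2)]] unfolding dim_over_base_def over_def by blast
  also have "\<dots> = poly_space.dim W - poly_space.dim ?J"
    using BJ(4) B fin poly_space.basis_card_eq_dim[OF B(2,4,3)] by (simp add: card_Diff_subset finite_subset)
  finally show ?thesis .
qed

lemma h_vector_eq_hilbert_fun:
  assumes I: "ideal I (poly_ring r)" and "1 \<notin> I"
  shows "h_vector r I = hilbert_fun r I"
  using dim_over_base_image[OF assms subspace_forms subset_refl]
  by (auto simp: h_vector_def graded_piece_def hilbert_fun_def)

text \<open>
  Annihilating the classes of the variables is enough, since the annihilator of an element is an
  ideal.
\<close>

lemma socle_graded_piece: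
  fixes I :: "'k::field mpoly set"
  assumes I: "ideal I (poly_ring r)"
  shows "socle r I \<inter> graded_piece r I i = quot_class r I ` socle_forms r I i"
proof -
  let ?cl = "quot_class r I" and ?Q = "quot_alg r I"
  interpret Q: cring ?Q by (rule ideal.quotient_is_cring[OF I cring_poly_ring])
  have form: "F \<in> carrier (poly_ring r)" if "F \<in> forms r i" for F :: "'k mpoly"
    using that forms_subset_carrier by blast
  have var: "poly_var j \<in> carrier (poly_ring r :: 'k mpoly ring)" if "j < r" for j
    using poly_var_in_forms[OF that] forms_subset_carrier by blast
  have var_cl: "?cl ` poly_var ` {..<r} \<subseteq> carrier ?Q"
    using quot_class_closed[OF I var] by blast
  have mult_var: "?cl F \<otimes>\<^bsub>?Q\<^esub> ?cl (poly_var j) = \<zero>\<^bsub>?Q\<^esub> \<longleftrightarrow> poly_var j * F \<in> I"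
    if "F \<in> forms r i" "j < r" for F j
  proof -
    have "poly_var j * F \<in> carrier (poly_ring r)"
      using forms_mult_linear[OF poly_var_in_forms[OF that(2)] that(1)] forms_subset_carrier by blast
    then show ?thesis
      using quot_class_hom(2)[OF I form[OF that(1)] var[OF that(2)]] quot_class_eq_0_iff[OF I]
      by (simp add: mult.commute)
  qed
  have "?cl F \<in> socle r I \<longleftrightarrow> F \<in> socle_forms r I i" if F: "F \<in> forms r i" for F
  proof
    assume "?cl F \<in> socle r I"
    moreover have "?cl (poly_var j) \<in> max_ideal r I" if "j < r" for j
      using Q.genideal_self[OF var_cl] that unfolding max_ideal_def by blast
    ultimately show "F \<in> socle_forms r I i"
      using F mult_var unfolding socle_def socle_forms_def by blast
  next
    assume soc: "F \<in> socle_forms r I i"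
    have cl_F: "?cl F \<in> carrier ?Q" by (rule quot_class_closed[OF I form[OF F]])
    let ?Ann = "{m \<in> carrier ?Q. ?cl F \<otimes>\<^bsub>?Q\<^esub> m \<in> {\<zero>\<^bsub>?Q\<^esub>}}"
    have "ideal ?Ann ?Q"
      by (rule ideal.helper_max_prime[OF Q.zeroideal Q.cring_axioms cl_F])
    moreover have "?cl ` poly_var ` {..<r} \<subseteq> ?Ann"
      using var_cl mult_var[OF F] soc unfolding socle_forms_def by auto
    ultimately have "max_ideal r I \<subseteq> ?Ann" unfolding max_ideal_def by (rule Q.genideal_minimal)
    then show "?cl F \<in> socle r I" using cl_F unfolding socle_def by blast
  qed
  moreover have "socle_forms r I i \<subseteq> forms r i" by (auto simp: socle_forms_def)
  ultimately show ?thesis unfolding graded_piece_def by blast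
qed

lemma socle_vector_eq:
  fixes I :: "'k::field mpoly set"
  assumes I: "ideal I (poly_ring r)" and "1 \<notin> I"
  shows "socle_vector r I i
    = poly_space.dim (socle_forms r I i) - poly_space.dim (I \<inter> forms r i)"
  unfolding socle_vector_def socle_graded_piece[OF I]
  by (rule dim_over_base_image[OF assms subspace_socle_forms[OF I] _ ideal_forms_subset_socle_forms[OF I]])
    (auto simp: socle_forms_def)

section \<open>Uniqueness of the socle-vector\<close>

text \<open>
  In each degree either \<open>h\<^sub>i\<close> is the least value allowed by \<open>h\<^sub>i\<^sub>+\<^sub>1\<close>, which leaves no room for a socle, or
  the growth from degree \<open>i + 1\<close> is maximal and both bounds on the socle forms meet. Degree 0 is of
  the first kind whatever the hypothesis on growth, because \<open>h\<^sub>0 \<le> 1\<close> and \<open>h\<^sub>1 \<ge> 1\<close>.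
\<close>

lemma socle_vector_formula:
  fixes I :: "'k::field_char_0 mpoly set"
  assumes alg: "std_graded_artinian r I"
    and growth: "\<forall>i \<ge> 2. binomial_shift (h_vector r I i) i (-1) \<noteq> h_vector r I (i - 1) \<longrightarrow>
      binomial_shift (h_vector r I i) i 1 = h_vector r I (i + 1)"
  shows "socle_vector r I i = h_vector r I i - rank_bound (Suc i) (h_vector r I (Suc i))"
proof -
  have I: "ideal I (poly_ring r)" and r: "1 \<le> r" and I1: "I \<inter> forms r 1 = {0}"
    using alg by (auto simp: std_graded_artinian_def homogeneous_ideal_def)
  have var_ne: "poly_var 0 \<noteq> (0 :: 'k mpoly)"
    unfolding poly_var_def by (metis lookup_single_eq lookup_zero zero_neq_one)
  have "1 \<notin> I"
  proof
    assume "1 \<in> I"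
    then have "poly_var 0 * 1 \<in> I" using r by (intro form_times_ideal[OF I poly_var_in_forms[of 0 r]]) auto
    then have "poly_var 0 \<in> I \<inter> forms r 1" using poly_var_in_forms[of 0 r] r by auto
    then show False using I1 var_ne by blast
  qed
  note h = h_vector_eq_hilbert_fun[OF I this] and s = socle_vector_eq[OF I this, of i]
  let ?h = "hilbert_fun r I"
  have J_le: "poly_space.dim (I \<inter> forms r i) \<le> poly_space.dim (socle_forms r I i)"
    by (rule dim_mono_forms[OF _ ideal_forms_subset_socle_forms[OF I]]) (auto simp: socle_forms_def)
  have T_le: "poly_space.dim (socle_forms r I i) \<le> poly_space.dim (forms r i :: 'k mpoly set)"
    by (rule dim_mono_forms) (auto simp: socle_forms_def)
  have lower: "poly_space.dim (socle_forms r I i) + rank_bound (Suc i) (?h (Suc i))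
      \<le> poly_space.dim (forms r i :: 'k mpoly set)"
    by (rule rank_bound_le_codim_socle_forms[OF I])
  have "rank_bound (Suc i) (?h (Suc i)) = ?h i
      \<or> ?h (Suc (Suc i)) = ?h (Suc i) + growth_excess (Suc i) (?h (Suc i))" if "i \<noteq> 0"
    using spec[OF growth, of "Suc i"] that unfolding h
    by (auto simp: binomial_shift_down binomial_shift_up)
  then consider "rank_bound (Suc i) (?h (Suc i)) = ?h i"
    | "?h (Suc (Suc i)) = ?h (Suc i) + growth_excess (Suc i) (?h (Suc i))"
    | "i = 0"
    by blast
  then have "poly_space.dim (forms r i :: 'k mpoly set)
      \<le> poly_space.dim (socle_forms r I i) + rank_bound (Suc i) (?h (Suc i))"
  proof cases
    case 1
    then show ?thesis using J_le unfolding hilbert_fun_def[of r I i] by linarith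
  next
    case 2
    then show ?thesis by (rule codim_socle_forms_le_rank_bound[OF I])
  next
    case 3
    have "forms r 1 \<noteq> {0 :: 'k mpoly}" using poly_var_in_forms[of 0 r] r var_ne by auto
    moreover have "{0 :: 'k mpoly} = forms r 1" if "poly_space.dim (forms r 1 :: 'k mpoly set) \<le> 0"
      using that poly_space.subspace_0[OF subspace_forms[of r 1]]
      by (intro forms_subspace_eqI[of _ r 1]) (auto simp: poly_space.subspace_single_0)
    ultimately have "1 \<le> poly_space.dim (forms r 1 :: 'k mpoly set)" by (metis not_less_eq_eq One_nat_def)
    moreover have "poly_space.dim {0 :: 'k mpoly} = 0"
      using poly_space.dim_le_card[of "{0}" "{}"] by simp
    ultimately have "1 \<le> ?h 1" unfolding hilbert_fun_def I1 by simp
    then have "rank_bound (Suc i) (?h (Suc i)) = 1" using 3 by (simp add: rank_bound_1_left)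
    then show ?thesis using 3 forms_0_dim_le[of r, where 'k = 'k] by simp
  qed
  with lower J_le show ?thesis unfolding s h hilbert_fun_def[of r I i] by linarith
qed

theorem corollary3p7:
  fixes h :: "nat \<Rightarrow> nat"
  assumes h_is_h_vector:
    "\<exists>r (I :: 'k::field_char_0 mpoly set). std_graded_artinian r I \<and> h_vector r I = h"
  assumes growth:
    "\<forall>i \<ge> 2. binomial_shift (h i) i (-1) \<noteq> h (i - 1) \<longrightarrow> binomial_shift (h i) i 1 = h (i + 1)"
  shows "\<exists>!s. \<exists>r (I :: 'k mpoly set).
           std_graded_artinian r I \<and> h_vector r I = h \<and> socle_vector r I = s"
proof -
  have formula: "socle_vector r I = (\<lambda>i. h i - rank_bound (Suc i) (h (Suc i)))"
    if "std_graded_artinian r I" "h_vector r I = h" for r and I :: "'k mpoly set"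
    using socle_vector_formula[OF that(1)] growth that(2) by blast
  obtain r and I :: "'k mpoly set" where alg: "std_graded_artinian r I" "h_vector r I = h"
    using h_is_h_vector by blast
  show ?thesis
  proof (rule ex1I)
    show "\<exists>r (I :: 'k mpoly set). std_graded_artinian r I \<and> h_vector r I = h
        \<and> socle_vector r I = (\<lambda>i. h i - rank_bound (Suc i) (h (Suc i)))"
      using alg formula[OF alg] by blast
  qed (use formula in blast)
qed

end
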